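(* Let $T_1,T_2,S_1,S_2\in\mathcal{B}_A(\mathcal{H})$, let $\mathbb{T}=\begin{bmatrix} 0& T_1\\ T_2& 0\end{bmatrix}$ and $\mathbb{S}=\begin{bmatrix} 0& S_1\\ S_2& 0\end{bmatrix}$ on $\mathcal{H}\oplus\mathcal{H}$, and let $\beta\ge 0$. Then for all $r\ge 1$, $$\omega_{\mathbb{A}}^{4r}\left(\mathbb{S}^{\sharp_{\mathbb{A}}}\mathbb{T}\right)\le \frac{1+2\beta}{16(\beta+1)}\max\{\phi_r^2,\psi_r^2\}+\frac{3+2\beta}{8(\beta+1)}\max\{\phi_r,\psi_r\}\max\{\rho_r,\theta_r\},$$ where $\phi_r=\|(T_2^{\sharp_A}T_2)^{2r}+(S_2^{\sharp_A}S_2)^{2r}\|_A$, $\psi_r=\|(T_1^{\sharp_A}T_1)^{2r}+(S_1^{\sharp_A}S_1)^{2r}\|_A$, $\rho_r=\omega_A^{r}(S_2^{\sharp_A}S_2T_2^{\sharp_A}T_2)$ and $\theta_r=\omega_A^{r}(S_1^{\sharp_A}S_1T_1^{\sharp_A}T_1)$.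
   Context: $\mathcal{H}$ is a complex Hilbert space, $\mathcal{B}(\mathcal{H})$ the bounded linear operators on it, and $A\in\mathcal{B}(\mathcal{H})$ is a fixed positive (semidefinite) operator. Put $\langle x,y\rangle_A=\langle Ax,y\rangle$ and $\|x\|_A=\langle x,x\rangle_A^{1/2}$. $\mathcal{B}_A(\mathcal{H})$ is the set of $T\in\mathcal{B}(\mathcal{H})$ for which there is $S\in\mathcal{B}(\mathcal{H})$ with $AS=T^*A$; for such $T$, $T^{\sharp_A}=A^\dagger T^*A$ ($A^\dagger$ the Moore-Penrose inverse), i.e. the unique bounded solution $S$ of $AS=T^*A$ with range in $\overline{\mathrm{ran}(A)}$. The $A$-operator seminorm is $\|T\|_A=\sup\{\|Tx\|_A/\|x\|_A : x\in\overline{\mathrm{ran}(A)},\ x\ne 0\}$, and the $A$-numerical radius is $\omega_A(T)=\sup\{|\langle Tx,x\rangle_A| : x\in\mathcal{H},\ \|x\|_A=1\}$. On $\mathcal{H}\oplus\mathcal{H}$ let $\mathbb{A}=\begin{bmatrix}A&0\\0&A\end{bmatrix}$, and put $\langle z,w\rangle_{\mathbb{A}}=\langle \mathbb{A}z,w\rangle$ and $\|z\|_{\mathbb{A}}=\langle z,z\rangle_{\mathbb{A}}^{1/2}$ for $z,w\in\mathcal{H}\oplus\mathcal{H}$. For a bounded operator $\mathbb{X}$ on $\mathcal{H}\oplus\mathcal{H}$ whose entries lie in $\mathcal{B}_A(\mathcal{H})$, $\mathbb{X}^{\sharp_{\mathbb{A}}}=\mathbb{A}^\dagger\mathbb{X}^*\mathbb{A}$,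 i.e. the unique bounded solution $\mathbb{Y}$ of $\mathbb{A}\mathbb{Y}=\mathbb{X}^*\mathbb{A}$ with range in $\overline{\mathrm{ran}(\mathbb{A})}$, and $\omega_{\mathbb{A}}(\mathbb{X})=\sup\{|\langle \mathbb{X}z,z\rangle_{\mathbb{A}}| : z\in\mathcal{H}\oplus\mathcal{H},\ \|z\|_{\mathbb{A}}=1\}$. $\omega_A^s(T)$ means $(\omega_A(T))^s$, and $\omega_{\mathbb{A}}^s(\mathbb{X})$ means $(\omega_{\mathbb{A}}(\mathbb{X}))^s$. Powers: an operator $S\in\mathcal{B}_A(\mathcal{H})$ is $A$-positive if $AS\ge 0$ (e.g. $T^{\sharp_A}T$ and $TT^{\sharp_A}$). Every $S\in\mathcal{B}_A(\mathcal{H})$ induces a bounded operator $\tilde S$ on the Hilbert space completion of $\mathcal{H}/\ker A$ under $\langle\cdot,\cdot\rangle_A$, with $\|\tilde S\|=\|S\|_A$, and $\tilde S\ge 0$ if $S$ is $A$-positive; for real $s>0$ and $A$-positive $S,R$, $\|S^s+R^s\|_A$ means $\|\tilde S^s+\tilde R^s\|$ (for integer $s$ this is the seminorm of the ordinary sum of powers). *)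

theory Defs
  imports "HOL-Analysis.Analysis" "HOL-Computational_Algebra.Polynomial"
begin

section \<open>Complex Hilbert spaces\<close>

text \<open>
  A complex inner product space is presented as a real inner product space (whose inner product is
  the real part of the complex one, hence has the same norm and topology) with a compatible complex
  structure. The complex inner product is linear in the first argument.
\<close>

class complex_inner = real_inner +
  fixes scaleC :: "complex \<Rightarrow> 'a \<Rightarrow> 'a"  (infixr \<open>*\<^sub>C\<close> 75)
    and cinner :: "'a \<Rightarrow> 'a \<Rightarrow> complex"
  assumes scaleC_add_right: "c *\<^sub>C (x + y) = c *\<^sub>C x + c *\<^sub>C y"
    and scaleC_add_left: "(c + d) *\<^sub>C x = c *\<^sub>C x + d *\<^sub>C x"
    and scaleC_scaleC: "c *\<^sub>C d *\<^sub>C x = (c * d) *\<^sub>C x"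
    and scaleC_of_real: "complex_of_real a *\<^sub>C x = scaleR a x"
    and cinner_commute: "cinner x y = cnj (cinner y x)"
    and cinner_add_left: "cinner (x + y) z = cinner x z + cinner y z"
    and cinner_scaleC_left: "cinner (c *\<^sub>C x) y = c * cinner x y"
    and inner_eq_Re_cinner: "inner x y = Re (cinner x y)"

class chilbert_space = complex_inner + complete_space

text \<open>The Hilbert space direct sum of two spaces is the product type.\<close>

instantiation prod :: (complex_inner, complex_inner) complex_inner
begin

definition scaleC_prod :: "complex \<Rightarrow> 'a \<times> 'b \<Rightarrow> 'a \<times> 'b" where
  "scaleC_prod c z = (c *\<^sub>C fst z, c *\<^sub>C snd z)"

definition cinner_prod :: "'a \<times> 'b \<Rightarrow> 'a \<times> 'b \<Rightarrow> complex" where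
  "cinner_prod z w = cinner (fst z) (fst w) + cinner (snd z) (snd w)"

instance
proof
  fix c d :: complex and a :: real and x y z :: "'a \<times> 'b"
  show "c *\<^sub>C (x + y) = c *\<^sub>C x + c *\<^sub>C y"
    by (simp add: scaleC_prod_def scaleC_add_right)
  show "(c + d) *\<^sub>C x = c *\<^sub>C x + d *\<^sub>C x"
    by (simp add: scaleC_prod_def scaleC_add_left)
  show "c *\<^sub>C d *\<^sub>C x = (c * d) *\<^sub>C x"
    by (simp add: scaleC_prod_def scaleC_scaleC)
  show "complex_of_real a *\<^sub>C x = scaleR a x"
    by (simp add: scaleC_prod_def scaleC_of_real scaleR_prod_def)
  show "cinner x y = cnj (cinner y x)"
    by (metis cinner_commute cinner_prod_def complex_cnj_add)
  show "cinner (x + y) z = cinner x z + cinner y z"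
    by (simp add: cinner_prod_def cinner_add_left)
  show "cinner (c *\<^sub>C x) y = c * cinner x y"
    by (simp add: cinner_prod_def scaleC_prod_def cinner_scaleC_left distrib_left)
  show "inner x y = Re (cinner x y)"
    by (simp add: cinner_prod_def inner_prod_def inner_eq_Re_cinner)
qed

end

instance prod :: (chilbert_space, chilbert_space) chilbert_space ..


section \<open>Bounded operators\<close>

definition bounded_clinear :: "('a::complex_inner \<Rightarrow> 'b::complex_inner) \<Rightarrow> bool" where
  "bounded_clinear T \<longleftrightarrow> bounded_linear T \<and> (\<forall>c x. T (c *\<^sub>C x) = c *\<^sub>C T x)"

definition positive_op :: "('a::complex_inner \<Rightarrow> 'a) \<Rightarrow> bool" where
  "positive_op A \<longleftrightarrow> bounded_clinear A \<and> (\<forall>x. cinner (A x) x \<in> \<real>\<^sub>\<ge>\<^sub>0)"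

definition cadjoint :: "('a::complex_inner \<Rightarrow> 'b::complex_inner) \<Rightarrow> 'b \<Rightarrow> 'a" where
  "cadjoint T = (THE S. bounded_clinear S \<and> (\<forall>x y. cinner (T x) y = cinner x (S y)))"

definition block_op ::
    "('a::complex_inner \<Rightarrow> 'a) \<Rightarrow> ('a \<Rightarrow> 'a) \<Rightarrow> ('a \<Rightarrow> 'a) \<Rightarrow> ('a \<Rightarrow> 'a) \<Rightarrow> 'a \<times> 'a \<Rightarrow> 'a \<times> 'a" where
  "block_op X11 X12 X21 X22 z = (X11 (fst z) + X12 (snd z), X21 (fst z) + X22 (snd z))"


section \<open>The semi-inner product of a positive operator\<close>

definition A_inner :: "('a::complex_inner \<Rightarrow> 'a) \<Rightarrow> 'a \<Rightarrow> 'a \<Rightarrow> complex" where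
  "A_inner A x y = cinner (A x) y"

definition A_norm :: "('a::complex_inner \<Rightarrow> 'a) \<Rightarrow> 'a \<Rightarrow> real" where
  "A_norm A x = sqrt (Re (A_inner A x x))"

definition B_A :: "('a::complex_inner \<Rightarrow> 'a) \<Rightarrow> ('a \<Rightarrow> 'a) set" where
  "B_A A = {T. bounded_clinear T \<and> (\<exists>S. bounded_clinear S \<and> A \<circ> S = cadjoint T \<circ> A)}"

definition A_sharp :: "('a::complex_inner \<Rightarrow> 'a) \<Rightarrow> ('a \<Rightarrow> 'a) \<Rightarrow> 'a \<Rightarrow> 'a" where
  "A_sharp A T =
    (THE S. bounded_clinear S \<and> A \<circ> S = cadjoint T \<circ> A \<and> range S \<subseteq> closure (range A))"

text \<open>
  The supremum is one of nonnegative numbers. Inserting 0 changes nothing unless \<open>A = 0\<close>, where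
  there are no vectors of seminorm 1 and the supremum of the empty set is thereby 0.
\<close>

definition A_numrad :: "('a::complex_inner \<Rightarrow> 'a) \<Rightarrow> ('a \<Rightarrow> 'a) \<Rightarrow> real" where
  "A_numrad A T = Sup (insert 0 {cmod (A_inner A (T x) x) | x. A_norm A x = 1})"


section \<open>The completion\<close>

text \<open>
  The Hilbert space completion of \<open>H / ker A\<close> under the inner product induced by \<open>A_inner A\<close>, as
  the set of sequences in \<open>H\<close> that are Cauchy for \<open>A_norm A\<close>, modulo sequences tending
  to 0 in \<open>A_norm A\<close>. Since \<open>ker A\<close> is the set of vectors of seminorm 0, the passage to
  \<open>H / ker A\<close> is part of this identification. A point of the completion is an equivalence class.
\<close>

definition A_Cauchy :: "('a::complex_inner \<Rightarrow> 'a) \<Rightarrow> (nat \<Rightarrow> 'a) set" where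
  "A_Cauchy A = {X. \<forall>e>0. \<exists>M. \<forall>m\<ge>M. \<forall>n\<ge>M. A_norm A (X m - X n) < e}"

definition A_equiv :: "('a::complex_inner \<Rightarrow> 'a) \<Rightarrow> ((nat \<Rightarrow> 'a) \<times> (nat \<Rightarrow> 'a)) set" where
  "A_equiv A = {(X, Y). X \<in> A_Cauchy A \<and> Y \<in> A_Cauchy A \<and>
                        (\<lambda>n. A_norm A (X n - Y n)) \<longlonglongrightarrow> 0}"

definition A_class :: "('a::complex_inner \<Rightarrow> 'a) \<Rightarrow> (nat \<Rightarrow> 'a) \<Rightarrow> (nat \<Rightarrow> 'a) set" where
  "A_class A X = A_equiv A `` {X}"

definition A_compl :: "('a::complex_inner \<Rightarrow> 'a) \<Rightarrow> (nat \<Rightarrow> 'a) set set" where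
  "A_compl A = A_Cauchy A // A_equiv A"

text \<open>
  The Hilbert space structure of the completion. The unions range over representatives; as the
  operations respect \<open>A_equiv A\<close>, all the united classes coincide.
\<close>

definition compl_zero :: "('a::complex_inner \<Rightarrow> 'a) \<Rightarrow> (nat \<Rightarrow> 'a) set" where
  "compl_zero A = A_class A (\<lambda>n. 0)"

definition compl_add ::
    "('a::complex_inner \<Rightarrow> 'a) \<Rightarrow> (nat \<Rightarrow> 'a) set \<Rightarrow> (nat \<Rightarrow> 'a) set \<Rightarrow> (nat \<Rightarrow> 'a) set" where
  "compl_add A u v = (\<Union>X\<in>u. \<Union>Y\<in>v. A_class A (\<lambda>n. X n + Y n))"

definition compl_scale ::
    "('a::complex_inner \<Rightarrow> 'a) \<Rightarrow> complex \<Rightarrow> (nat \<Rightarrow> 'a) set \<Rightarrow> (nat \<Rightarrow> 'a) set" where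
  "compl_scale A c u = (\<Union>X\<in>u. A_class A (\<lambda>n. c *\<^sub>C X n))"

definition compl_diff ::
    "('a::complex_inner \<Rightarrow> 'a) \<Rightarrow> (nat \<Rightarrow> 'a) set \<Rightarrow> (nat \<Rightarrow> 'a) set \<Rightarrow> (nat \<Rightarrow> 'a) set" where
  "compl_diff A u v = compl_add A u (compl_scale A (-1) v)"

definition compl_inner ::
    "('a::complex_inner \<Rightarrow> 'a) \<Rightarrow> (nat \<Rightarrow> 'a) set \<Rightarrow> (nat \<Rightarrow> 'a) set \<Rightarrow> complex" where
  "compl_inner A u v = (THE l. \<exists>X\<in>u. \<exists>Y\<in>v. (\<lambda>n. A_inner A (X n) (Y n)) \<longlonglongrightarrow> l)"

definition compl_norm :: "('a::complex_inner \<Rightarrow> 'a) \<Rightarrow> (nat \<Rightarrow> 'a) set \<Rightarrow> real" where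
  "compl_norm A u = sqrt (Re (compl_inner A u u))"

text \<open>The operator induced on the completion: the continuous extension of \<open>x + ker A \<mapsto> S x + ker A\<close>.\<close>

definition compl_lift ::
    "('a::complex_inner \<Rightarrow> 'a) \<Rightarrow> ('a \<Rightarrow> 'a) \<Rightarrow> (nat \<Rightarrow> 'a) set \<Rightarrow> (nat \<Rightarrow> 'a) set" where
  "compl_lift A S u = (\<Union>X\<in>u. A_class A (\<lambda>n. S (X n)))"

definition compl_opnorm ::
    "('a::complex_inner \<Rightarrow> 'a) \<Rightarrow> ((nat \<Rightarrow> 'a) set \<Rightarrow> (nat \<Rightarrow> 'a) set) \<Rightarrow> real" where
  "compl_opnorm A F = Sup {compl_norm A (F u) | u. u \<in> A_compl A \<and> compl_norm A u \<le> 1}"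


section \<open>Real powers of positive operators on the completion\<close>

text \<open>Evaluation \<open>p(F)\<close> of a real polynomial at an operator \<open>F\<close> on the completion (Horner scheme).\<close>

definition compl_poly ::
    "('a::complex_inner \<Rightarrow> 'a) \<Rightarrow> real poly \<Rightarrow> ((nat \<Rightarrow> 'a) set \<Rightarrow> (nat \<Rightarrow> 'a) set) \<Rightarrow>
     (nat \<Rightarrow> 'a) set \<Rightarrow> (nat \<Rightarrow> 'a) set" where
  "compl_poly A p F =
    fold_coeffs (\<lambda>a G u. compl_add A (compl_scale A (complex_of_real a) u) (F (G u)))
      p (\<lambda>u. compl_zero A)"

text \<open>
  \<open>F\<^sup>s\<close> for a positive operator \<open>F\<close> on the completion and real \<open>s > 0\<close>, by the continuous
  functional calculus: it is the limit in operator norm of \<open>p\<^sub>n(F)\<close> for all sequences of polynomials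
  \<open>p\<^sub>n\<close> converging to \<open>t\<^sup>s\<close> uniformly on the interval from 0 to the norm of \<open>F\<close>, which contains the
  spectrum of \<open>F\<close>. Convergence in operator norm is spelled out; membership in the extensional
  function space makes the operator unique also as a HOL function.
\<close>

definition compl_powr ::
    "('a::complex_inner \<Rightarrow> 'a) \<Rightarrow> ((nat \<Rightarrow> 'a) set \<Rightarrow> (nat \<Rightarrow> 'a) set) \<Rightarrow> real \<Rightarrow>
     (nat \<Rightarrow> 'a) set \<Rightarrow> (nat \<Rightarrow> 'a) set" where
  "compl_powr A F s =
    (THE G. G \<in> A_compl A \<rightarrow>\<^sub>E A_compl A \<and>
      (\<forall>p. uniform_limit {0..compl_opnorm A F} (\<lambda>n. poly (p n)) (\<lambda>t. t powr s) sequentially \<longrightarrow>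
        (\<forall>e>0. \<forall>\<^sub>F n in sequentially. \<forall>u\<in>A_compl A.
          compl_norm A (compl_diff A (compl_poly A (p n) F u) (G u)) \<le> e * compl_norm A u)))"

text \<open>The number written \<open>\<parallel>S\<^sup>s + R\<^sup>s\<parallel>\<^sub>A\<close> for \<open>A\<close>-positive \<open>S\<close>, \<open>R\<close> and real \<open>s > 0\<close>.\<close>

definition A_norm_powr_add ::
    "('a::complex_inner \<Rightarrow> 'a) \<Rightarrow> ('a \<Rightarrow> 'a) \<Rightarrow> ('a \<Rightarrow> 'a) \<Rightarrow> real \<Rightarrow> real" where
  "A_norm_powr_add A S R s =
    compl_opnorm A (\<lambda>u. compl_add A (compl_powr A (compl_lift A S) s u)
                                    (compl_powr A (compl_lift A R) s u))"

end

(* For x with A_norm A x = 1 put P = T# T, Q = S# S, m = |Px| |Qx| and c = |<Px,Qx>|, all in the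
   semi-inner product of A. Then |<Tx,Sx>|^2 \<le> <Px,x><Qx,x> \<le> (m + c)/2 by Cauchy-Schwarz and Buzano,
   so |<Tx,Sx>|^4 \<le> \<alpha> m^2 + (1 - \<alpha>) m c for every \<alpha> between 1/4 and 1, in particular for
   \<alpha> = (1 + 2\<beta>)/(4(\<beta> + 1)). Convexity of t^r, the bound m^r \<le> (|Px|^(2r) + |Qx|^(2r))/2 and
   McCarthy's inequality |Px|^(2r) \<le> <P^(2r) x,x> give the estimate for one pair (T, S); the product
   of the two off-diagonal block operators is diagonal, so the two estimates combine.
   The powers on the completion exist because |p(S)x| \<le> (sup of |p| on [0, M]) |x| for real
   polynomials p; this follows from positivity of p(S) for p \<ge> 0 on [0, M], obtained from
   Bernstein's approximation. *)
theory Submission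
  imports Defs
begin

text \<open>The powers are the formal obstacle: \<open>compl_powr\<close> is a definite description
  over functions on equivalence classes, and its polynomials approximate t^s only on the interval
  ending exactly at the operator norm M. So the polynomial estimates must hold with that sharp
  endpoint, and they are proved in H itself for the seminorm. Knowledge of the spectrum is replaced
  by positivity of 1, t, M - t and t(M - t) at the operator, the last one from S^2 \<le> M S. The
  limit of p_n(S) is realised by the diagonal sequence p_n(S) X_n, which is directly a Cauchy
  sequence in H. Boundedness in the seminorm has itself to be derived, from selfadjointness. The
  range of \<alpha>: c \<le> m gives (m + c)^2/4 \<le> m^2/4 + 3mc/4, and mc \<le> m^2 allows weight
  to move from mc to m^2. The given \<alpha> runs through [1/4, 1/2) as \<beta> grows from 0. Then
  m^r \<le> \<phi>/2 turns the weights \<alpha> and 1 - \<alpha> into the coefficients \<alpha>/4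
  and (1 - \<alpha>)/2 of the theorem.\<close>

section \<open>Calculus of the complex inner product\<close>

lemma cinner_add_right: "cinner x (y + z) = cinner x y + cinner x z"
  by (metis cinner_add_left cinner_commute complex_cnj_add)

lemma cinner_scaleC_right: "cinner x (c *\<^sub>C y) = cnj c * cinner x y"
  by (metis cinner_commute cinner_scaleC_left complex_cnj_mult)

lemma scaleC_minus_one: "(-1) *\<^sub>C x = - x"
  using scaleC_of_real[of "-1" x] by simp

lemma cinner_minus_left: "cinner (- x) y = - cinner x y"
  using cinner_scaleC_left[of "-1" x y] by (simp add: scaleC_minus_one)

lemma cinner_diff_left: "cinner (x - y) z = cinner x z - cinner y z"
  using cinner_add_left[of x "- y" z] by (simp add: cinner_minus_left)

lemma cinner_diff_right: "cinner x (y - z) = cinner x y - cinner x z"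
  by (metis cinner_commute cinner_diff_left complex_cnj_diff)

lemma cinner_eqI: "(\<And>y. cinner x y = cinner z y) \<Longrightarrow> x = z"
  by (metis inner_eq_Re_cinner inner_commute vector_eq_rdot)

lemma norm_scaleC: "norm (c *\<^sub>C x) = cmod c * norm (x :: 'a::complex_inner)"
proof -
  have "cinner (c *\<^sub>C x) (c *\<^sub>C x) = c * (cnj c * cinner x x)"
    by (simp only: cinner_scaleC_left cinner_scaleC_right mult.left_commute)
  also have "\<dots> = of_real ((cmod c)\<^sup>2) * cinner x x"
    by (subst complex_norm_square) (simp add: mult_ac)
  finally have "(norm (c *\<^sub>C x))\<^sup>2 = (cmod c * norm x)\<^sup>2"
    by (simp add: power_mult_distrib power2_norm_eq_inner inner_eq_Re_cinner)
  then show ?thesis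
    by (simp add: power2_eq_iff_nonneg)
qed

lemma scaleC_diff_right: "c *\<^sub>C (x - y) = c *\<^sub>C x - c *\<^sub>C (y :: 'a::complex_inner)"
  by (metis scaleC_add_right add_diff_cancel_right' diff_add_cancel)

lemma bounded_linear_scaleC: "bounded_linear (\<lambda>x :: 'a::complex_inner. c *\<^sub>C x)"
proof (rule bounded_linear_intro)
  fix x y :: 'a and a :: real
  show "c *\<^sub>C (x + y) = c *\<^sub>C x + c *\<^sub>C y" by (rule scaleC_add_right)
  show "c *\<^sub>C scaleR a x = scaleR a (c *\<^sub>C x)"
    by (metis scaleC_of_real scaleC_scaleC mult.commute)
  show "norm (c *\<^sub>C x) \<le> norm x * cmod c" by (simp add: norm_scaleC mult.commute)
qed

lemma bounded_clinear_compose: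
  "bounded_clinear S \<Longrightarrow> bounded_clinear T \<Longrightarrow> bounded_clinear (S \<circ> T)"
  unfolding bounded_clinear_def comp_def by (auto intro: bounded_linear_compose)


section \<open>Projections, adjoints, and the A-adjoint\<close>

text \<open>A minimizing sequence for the distance from x to V is Cauchy by the parallelogram law,
  because midpoints stay in V. Its limit is a nearest point, and at a nearest point the first
  variation in each direction w of V vanishes.\<close>

lemma exists_projection:
  fixes V :: "'a::{real_inner,complete_space} set"
  assumes "subspace V" "closed V"
  shows "\<exists>v\<in>V. \<forall>w\<in>V. inner (x - v) w = 0"
proof -
  define d where "d = infdist x V"
  have V0: "V \<noteq> {}" using assms(1) subspace_0 by blast
  have dle: "d \<le> norm (x - v)" if "v \<in> V" for v
    using infdist_le[OF that, of x] by (simp add: d_def dist_norm)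
  have d0: "d \<ge> 0" by (simp add: d_def infdist_nonneg)
  have "\<exists>v\<in>V. norm (x - v) < d + inverse (real (Suc n))" for n
  proof (rule ccontr)
    assume *: "\<not> ?thesis"
    have "d + inverse (real (Suc n)) \<le> infdist x V"
      unfolding infdist_notempty[OF V0]
      by (rule cINF_greatest[OF V0]) (use * in \<open>force simp: dist_norm\<close>)
    then show False by (simp add: d_def)
  qed
  then obtain v where v: "\<And>n. v n \<in> V" "\<And>n. norm (x - v n) < d + inverse (real (Suc n))"
    by metis
  have lim: "(\<lambda>n. norm (x - v n)) \<longlonglongrightarrow> d"
  proof (rule tendsto_sandwich[where f = "\<lambda>_. d" and h = "\<lambda>n. d + inverse (real (Suc n))"])
    show "(\<lambda>n. d + inverse (real (Suc n))) \<longlonglongrightarrow> d"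
      using LIMSEQ_inverse_real_of_nat_add[of d] by simp
  qed (use v dle in \<open>auto intro: less_imp_le always_eventually\<close>)
  have para: "(norm (v m - v n))\<^sup>2 \<le> 2 * (norm (x - v m))\<^sup>2 + 2 * (norm (x - v n))\<^sup>2 - 4 * d\<^sup>2" for m n
  proof -
    have "(1/2) *\<^sub>R (v m + v n) \<in> V"
      using assms(1) v(1) by (simp add: subspace_add subspace_scale)
    then have "d\<^sup>2 \<le> (norm (x - (1/2) *\<^sub>R (v m + v n)))\<^sup>2"
      using dle d0 by (intro power_mono) auto
    moreover have "4 * (norm (x - (1/2) *\<^sub>R (v m + v n)))\<^sup>2 + (norm (v m - v n))\<^sup>2
        = 2 * (norm (x - v m))\<^sup>2 + 2 * (norm (x - v n))\<^sup>2"
      by (simp add: power2_norm_eq_inner inner_diff_left inner_diff_right inner_add_left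
          inner_add_right inner_commute algebra_simps)
    ultimately show ?thesis by linarith
  qed
  have "Cauchy v"
  proof (rule metric_CauchyI)
    fix e :: real assume e: "e > 0"
    have "(\<lambda>n. (norm (x - v n))\<^sup>2) \<longlonglongrightarrow> d\<^sup>2" by (intro tendsto_intros lim)
    then have "\<forall>\<^sub>F n in sequentially. (norm (x - v n))\<^sup>2 < d\<^sup>2 + e\<^sup>2 / 4"
      by (rule order_tendstoD(2)) (use e in simp)
    then obtain M where M: "\<And>n. n \<ge> M \<Longrightarrow> (norm (x - v n))\<^sup>2 < d\<^sup>2 + e\<^sup>2 / 4"
      by (auto simp: eventually_sequentially)
    have "dist (v m) (v n) < e" if "m \<ge> M" "n \<ge> M" for m n
    proof -
      have "(norm (v m - v n))\<^sup>2 < e\<^sup>2" using para[of m n] M[OF that(1)] M[OF that(2)] by linarith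
      then show ?thesis using e by (simp add: dist_norm power_less_imp_less_base)
    qed
    then show "\<exists>M. \<forall>m\<ge>M. \<forall>n\<ge>M. dist (v m) (v n) < e" by blast
  qed
  then obtain p where p: "v \<longlonglongrightarrow> p" using Cauchy_convergent convergentD by blast
  have pV: "p \<in> V" using closed_sequentially[OF assms(2)] v(1) p by blast
  have "(\<lambda>n. norm (x - v n)) \<longlonglongrightarrow> norm (x - p)" by (intro tendsto_intros p)
  then have pd: "norm (x - p) = d" using lim LIMSEQ_unique by blast
  have "inner (x - p) w = 0" if w: "w \<in> V" for w
  proof (rule ccontr)
    assume ne: "inner (x - p) w \<noteq> 0"
    then have w0: "inner w w > 0" by force
    \<comment> \<open>The minimizer of the quadratic t \<mapsto> |x - (p + t w)|^2; it would bring
      the distance strictly below d.\<close>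
    define t where "t = inner (x - p) w / inner w w"
    have "p + t *\<^sub>R w \<in> V" using assms(1) pV w by (simp add: subspace_add subspace_scale)
    then have "d\<^sup>2 \<le> (norm (x - (p + t *\<^sub>R w)))\<^sup>2" using dle d0 by (intro power_mono) auto
    also have "\<dots> = (norm (x - p))\<^sup>2 - 2 * t * inner (x - p) w + t * t * inner w w"
      by (simp add: power2_norm_eq_inner inner_diff_left inner_diff_right inner_add_left
          inner_add_right inner_commute algebra_simps)
    also have "\<dots> = d\<^sup>2 - (inner (x - p) w)\<^sup>2 / inner w w"
      using w0 by (simp add: pd t_def power2_eq_square)
    finally show False using ne w0 by (simp add: divide_le_0_iff)
  qed
  then show ?thesis using pV by blast
qed

lemma riesz_representation:
  fixes f :: "'a::{real_inner,complete_space} \<Rightarrow> real"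
  assumes "bounded_linear f"
  shows "\<exists>z. \<forall>x. f x = inner x z"
proof (cases "\<forall>x. f x = 0")
  case True
  then show ?thesis by (intro exI[of _ 0]) simp
next
  case False
  then obtain x0 where x0: "f x0 \<noteq> 0" by blast
  interpret f: bounded_linear f by fact
  define V where "V = {x. f x = 0}"
  have "subspace V" by (simp add: V_def subspace_def f.add f.scale f.zero)
  moreover have "closed V"
    unfolding V_def by (intro closed_Collect_eq continuous_intros f.continuous_on)
  ultimately obtain v where v: "v \<in> V" "\<And>w. w \<in> V \<Longrightarrow> inner (x0 - v) w = 0"
    using exists_projection by metis
  define w where "w = x0 - v"
  have fw: "f w \<noteq> 0" using v(1) x0 by (simp add: w_def f.diff V_def)
  then have w0: "inner w w \<noteq> 0" using f.zero by auto
  have "f x = inner x ((f w / inner w w) *\<^sub>R w)" for x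
  proof -
    \<comment> \<open>Subtracting the right multiple of w lands in the kernel of f, to which w is
      orthogonal; this reads off f x from \<open>inner x w\<close>.\<close>
    have "x - (f x / f w) *\<^sub>R w \<in> V" using fw by (simp add: V_def f.diff f.scale)
    then have "inner w (x - (f x / f w) *\<^sub>R w) = 0" using v(2) by (simp add: w_def)
    then have "inner x w = f x / f w * inner w w"
      by (simp add: inner_diff_right inner_commute)
    then show ?thesis using fw w0 by (simp add: field_simps)
  qed
  then show ?thesis by blast
qed

lemma exists_cadjoint:
  fixes T :: "'a::chilbert_space \<Rightarrow> 'b::complex_inner"
  assumes "bounded_clinear T"
  shows "\<exists>S. bounded_clinear S \<and> (\<forall>x y. cinner (T x) y = cinner x (S y))"
proof -
  interpret T: bounded_linear T using assms by (simp add: bounded_clinear_def)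
  have TC: "T (c *\<^sub>C x) = c *\<^sub>C T x" for c x using assms by (simp add: bounded_clinear_def)
  have "\<exists>z. \<forall>x. inner (T x) y = inner x z" for y
    by (rule riesz_representation)
      (intro bounded_linear_compose[OF bounded_linear_inner_left T.bounded_linear_axioms])
  then obtain S where S: "\<And>x y. inner (T x) y = inner x (S y)" by metis
  have C: "cinner (T x) y = cinner x (S y)" for x y
  proof -
    have "Re (cinner (T x) y) = Re (cinner x (S y))" for x
      using S[of x y] by (simp add: inner_eq_Re_cinner)
    \<comment> \<open>Riesz on the underlying real space yields equality of real parts only.
      Replacing x by -i x turns the imaginary part into a real part.\<close>
    from this[of x] this[of "(-\<i>) *\<^sub>C x"] show ?thesis
      by (simp add: TC cinner_scaleC_left complex_eq_iff)
  qed
  have eqI: "u = v" if "\<And>x. cinner x u = cinner x v" for u v :: 'a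
    using that by (metis cinner_commute cinner_eqI)
  have "bounded_clinear S"
    unfolding bounded_clinear_def
  proof (intro conjI allI)
    show "S (c *\<^sub>C y) = c *\<^sub>C S y" for c y
      by (rule eqI) (simp add: C[symmetric] cinner_scaleC_right)
    obtain K where K: "\<And>x. norm (T x) \<le> norm x * K" "K \<ge> 0"
      using T.nonneg_bounded by blast
    show "bounded_linear S"
    proof (rule bounded_linear_intro)
      show "S (x + y) = S x + S y" for x y
        by (rule eqI) (simp add: C[symmetric] cinner_add_right)
      show "S (scaleR a y) = scaleR a (S y)" for a y
        by (rule eqI) (simp add: C[symmetric] cinner_scaleC_right flip: scaleC_of_real)
      show "norm (S y) \<le> norm y * K" for y
      proof (cases "norm (S y) = 0")
        case False
        have "norm (S y) * norm (S y) = inner (T (S y)) y"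
          by (simp add: S flip: power2_norm_eq_inner power2_eq_square)
        also have "\<dots> \<le> norm (T (S y)) * norm y"
          by (rule norm_cauchy_schwarz)
        also have "\<dots> \<le> (norm (S y) * K) * norm y"
          by (rule mult_right_mono[OF K(1)]) simp
        finally have "norm (S y) * norm (S y) \<le> norm (S y) * (norm y * K)"
          by (simp add: mult_ac)
        then show ?thesis using False by (simp add: mult_le_cancel_left)
      qed (use K in simp)
    qed
  qed
  then show ?thesis using C by blast
qed

lemma cadjoint:
  fixes T :: "'a::chilbert_space \<Rightarrow> 'b::complex_inner"
  assumes "bounded_clinear T"
  shows "cinner (T x) y = cinner x (cadjoint T y)"
proof -
  have "\<exists>!S. bounded_clinear S \<and> (\<forall>x y. cinner (T x) y = cinner x (S y))"
  proof (rule ex_ex1I[OF exists_cadjoint[OF assms]])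
    fix S R
    assume S: "bounded_clinear S \<and> (\<forall>x y. cinner (T x) y = cinner x (S y))"
      and R: "bounded_clinear R \<and> (\<forall>x y. cinner (T x) y = cinner x (R y))"
    have "S y = R y" for y
      by (rule cinner_eqI) (metis S R cinner_commute)
    then show "S = R" ..
  qed
  from theI'[OF this] show ?thesis
    unfolding cadjoint_def by blast
qed

text \<open>Moving \<open>cadjoint\<close> across the inner product turns the operator equation into
  a duality relation, so membership can be shown by exhibiting an adjoint for the semi-inner
  product.\<close>

lemma B_A_iff:
  fixes A :: "'a::chilbert_space \<Rightarrow> 'a"
  shows "T \<in> B_A A \<longleftrightarrow> bounded_clinear T \<and>
    (\<exists>S. bounded_clinear S \<and> (\<forall>x y. A_inner A (S x) y = A_inner A x (T y)))"
proof -
  have "A \<circ> S = cadjoint T \<circ> A \<longleftrightarrow> (\<forall>x y. A_inner A (S x) y = A_inner A x (T y))"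
    if "bounded_clinear T" for S
  proof -
    have "cinner (A x) (T y) = cinner (cadjoint T (A x)) y" for x y
      by (metis cadjoint[OF that] cinner_commute)
    then show ?thesis
      unfolding A_inner_def by (auto simp: fun_eq_iff intro: cinner_eqI)
  qed
  then show ?thesis unfolding B_A_def by blast
qed

lemma subspace_closure:
  fixes V :: "'a::real_normed_vector set"
  assumes "subspace V"
  shows "subspace (closure V)"
proof (rule subspaceI)
  show "0 \<in> closure V" using subspace_0[OF assms] closure_subset by blast
next
  fix x y assume "x \<in> closure V" "y \<in> closure V"
  then obtain X Y where "\<And>n. X n \<in> V" "X \<longlonglongrightarrow> x" "\<And>n. Y n \<in> V" "Y \<longlonglongrightarrow> y"
    unfolding closure_sequential by metis
  then have "\<forall>n. X n + Y n \<in> V" "(\<lambda>n. X n + Y n) \<longlonglongrightarrow> x + y"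
    by (auto intro: tendsto_add subspace_add[OF assms])
  then show "x + y \<in> closure V" unfolding closure_sequential by (intro exI[of _ "\<lambda>n. X n + Y n"]) auto
next
  fix c x assume "x \<in> closure V"
  then obtain X where "\<And>n. X n \<in> V" "X \<longlonglongrightarrow> x"
    unfolding closure_sequential by metis
  then have "\<forall>n. c *\<^sub>R X n \<in> V" "(\<lambda>n. c *\<^sub>R X n) \<longlonglongrightarrow> c *\<^sub>R x"
    by (auto intro: tendsto_scaleR subspace_scale[OF assms])
  then show "c *\<^sub>R x \<in> closure V" unfolding closure_sequential by (intro exI[of _ "\<lambda>n. c *\<^sub>R X n"]) auto
qed

lemma closure_range_scaleC:
  assumes "bounded_clinear A" "v \<in> closure (range A)"
  shows "c *\<^sub>C v \<in> closure (range A)"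
proof -
  obtain X where X: "\<And>n. X n \<in> range A" "X \<longlonglongrightarrow> v"
    using assms(2) unfolding closure_sequential by metis
  have "c *\<^sub>C X n \<in> range A" for n
  proof -
    obtain y where "X n = A y" using X(1)[of n] by blast
    then have "c *\<^sub>C X n = A (c *\<^sub>C y)" using assms(1) by (simp add: bounded_clinear_def)
    then show ?thesis by blast
  qed
  moreover have "(\<lambda>n. c *\<^sub>C X n) \<longlonglongrightarrow> c *\<^sub>C v"
    by (rule bounded_linear.tendsto[OF bounded_linear_scaleC X(2)])
  ultimately show ?thesis unfolding closure_sequential by (intro exI[of _ "\<lambda>n. c *\<^sub>C X n"]) blast
qed

text \<open>Polarization: the sesquilinear defect q vanishes on the diagonal because <Az, z> is
  real, and over the complex numbers this forces q = 0.\<close>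

lemma positive_op_sym:
  assumes "positive_op A"
  shows "cinner (A x) y = cinner x (A y)"
proof -
  have A: "bounded_linear A" "A (c *\<^sub>C x) = c *\<^sub>C A x" for c x
    using assms by (simp_all add: positive_op_def bounded_clinear_def)
  define q where "q x y = cinner (A x) y - cinner x (A y)" for x y
  have real: "cinner (A z) z = cinner z (A z)" for z
  proof -
    have "cinner (A z) z \<in> \<real>"
      using assms nonneg_Reals_subset_Reals by (auto simp: positive_op_def)
    then show ?thesis by (metis cinner_commute Reals_cnj_iff)
  qed
  have q0: "q z z = 0" for z using real by (simp add: q_def)
  have "q x y + q y x = 0"
    using q0[of "x + y"] q0[of x] q0[of y]
    by (simp add: q_def linear_add[OF bounded_linear.linear[OF A(1)]] cinner_add_left
        cinner_add_right algebra_simps)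
  \<comment> \<open>The vector x + y gives q x y = - q y x; the vector x + i y gives q x y = q y x,
    since q is conjugate linear in its second argument.\<close>
  moreover have "- \<i> * q x y + \<i> * q y x = 0"
    using q0[of "x + \<i> *\<^sub>C y"] q0[of x] q0[of y]
    by (simp add: q_def linear_add[OF bounded_linear.linear[OF A(1)]] A(2) cinner_add_left
        cinner_add_right cinner_scaleC_left cinner_scaleC_right algebra_simps)
  then have "\<i> * (q y x - q x y) = 0" by (simp add: algebra_simps)
  then have "q y x = q x y" by simp
  ultimately show ?thesis by (simp add: q_def)
qed

lemma positive_op_inner:
  assumes "positive_op A"
  shows "inner (A x) y = inner x (A y)"
  by (simp add: inner_eq_Re_cinner positive_op_sym[OF assms])

text \<open>A is selfadjoint, so vectors orthogonal to the closure of its range lie in its kernel,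
  and A is injective on that closure. Composing any solution S with the orthogonal projection P onto
  the closure thus gives the one solution with range there, and the definite description in
  \<open>A_sharp\<close> is legitimate.\<close>

lemma A_sharp:
  fixes A :: "'a::chilbert_space \<Rightarrow> 'a"
  assumes A: "positive_op A" and T: "T \<in> B_A A"
  shows "bounded_clinear (A_sharp A T)"
    and "A_inner A (A_sharp A T x) y = A_inner A x (T y)"
proof -
  have cl: "bounded_clinear A" using A by (simp add: positive_op_def)
  then interpret A: bounded_linear A by (simp add: bounded_clinear_def)
  obtain S where S: "bounded_clinear S" "A \<circ> S = cadjoint T \<circ> A" using T by (auto simp: B_A_def)
  let ?V = "closure (range A)"
  have V: "subspace ?V" "closed ?V"
    by (auto intro!: subspace_closure linear_subspace_image A.linear)
  obtain P where P: "\<And>x. P x \<in> ?V" "\<And>x w. w \<in> ?V \<Longrightarrow> inner (x - P x) w = 0"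
    using exists_projection[OF V] by metis
  have ker: "A v = 0" if "\<And>w. w \<in> ?V \<Longrightarrow> inner v w = 0" for v
  proof -
    have "inner v (A (A v)) = 0" using that closure_subset by blast
    then have "inner (A v) (A v) = 0" by (simp only: positive_op_inner[OF A, of v])
    then show ?thesis by simp
  qed
  have ker': "v = 0" if "A v = 0" "v \<in> ?V" for v
  proof -
    have "range A \<subseteq> {w. inner v w = 0}"
      using that(1) by (auto simp: positive_op_inner[OF A, of v, symmetric])
    moreover have "closed {w. inner v w = 0}" by (rule closed_hyperplane)
    ultimately have "?V \<subseteq> {w. inner v w = 0}" by (rule closure_minimal)
    then show ?thesis using that(2) by auto
  qed
  have AP: "A (P x) = A x" for x
    using ker[of "x - P x"] P by (simp add: A.diff)
  \<comment> \<open>Characterises P x by membership in the closure and its image under A, so that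
    additivity and homogeneity of P become instances of uniqueness.\<close>
  have Pu: "P x = v" if "v \<in> ?V" "A v = A x" for x v
    using ker'[of "P x - v"] that P(1)[of x] V(1) by (simp add: AP A.diff subspace_diff)
  have bl: "bounded_clinear P"
    unfolding bounded_clinear_def
  proof (intro conjI allI)
    show "P (c *\<^sub>C x) = c *\<^sub>C P x" for c x
      using cl AP[of x] closure_range_scaleC[OF cl P(1)]
      by (intro Pu) (auto simp: bounded_clinear_def)
    show "bounded_linear P"
    proof (rule bounded_linear_intro)
      show "P (x + y) = P x + P y" for x y
        by (intro Pu) (use V(1) P(1) AP in \<open>auto simp: subspace_add A.add\<close>)
      show "P (scaleR a x) = scaleR a (P x)" for a x
        by (intro Pu) (use V(1) P(1) AP in \<open>auto simp: subspace_scale A.scale\<close>)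
      show "norm (P x) \<le> norm x * 1" for x
      proof -
        have "inner (x - P x) (P x) = 0" using P by blast
        then have "norm (P x) * norm (P x) = inner x (P x)"
          by (simp add: inner_diff_left flip: power2_norm_eq_inner power2_eq_square)
        also have "\<dots> \<le> norm x * norm (P x)" by (rule norm_cauchy_schwarz)
        finally show ?thesis by (cases "norm (P x) = 0") (auto simp: mult_le_cancel_right)
      qed
    qed
  qed
  let ?Q = "\<lambda>S. bounded_clinear S \<and> A \<circ> S = cadjoint T \<circ> A \<and> range S \<subseteq> ?V"
  have "\<exists>!S. ?Q S"
  proof (rule ex1I[of _ "P \<circ> S"])
    show "?Q (P \<circ> S)"
      using S bl P(1) AP by (auto simp: fun_eq_iff intro: bounded_clinear_compose)
    fix R assume R: "?Q R"
    show "R = P \<circ> S"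
    proof
      fix x
      have "A (R x) = A (S x)" using R S(2) by (simp add: fun_eq_iff)
      then show "R x = (P \<circ> S) x" using Pu[of "R x" "S x"] R by (auto simp: image_subset_iff)
    qed
  qed
  from theI'[OF this] have Q: "?Q (A_sharp A T)" unfolding A_sharp_def .
  then show "bounded_clinear (A_sharp A T)" by blast
  have "A (A_sharp A T x) = cadjoint T (A x)" using Q by (simp add: fun_eq_iff)
  moreover have "cinner (cadjoint T (A x)) y = cnj (cinner (T y) (A x))"
    using T by (subst cinner_commute) (simp add: B_A_def cadjoint)
  ultimately show "A_inner A (A_sharp A T x) y = A_inner A x (T y)"
    by (simp add: A_inner_def flip: cinner_commute)
qed

section \<open>The semi-inner product\<close>

text \<open>Stated for an arbitrary form because it serves twice: for the semi-inner product, and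
  for the form <S x, y> of a positive operator S. Degeneracy rules out the usual division by b y y,
  hence the separate null case.\<close>

lemma semidefinite_cauchy_schwarz:
  fixes b :: "'a::real_vector \<Rightarrow> 'a \<Rightarrow> real"
  assumes "bilinear b" and sym: "\<And>x y. b x y = b y x" and nonneg: "\<And>x. b x x \<ge> 0"
  shows "(b x y)\<^sup>2 \<le> b x x * b y y"
proof -
  have exp: "0 \<le> b x x + 2 * t * b x y + t * t * b y y" for t
    using nonneg[of "x + t *\<^sub>R y"] assms(1)
    by (simp add: bilinear_ladd bilinear_radd bilinear_lmul bilinear_rmul sym[of y x] algebra_simps)
  show ?thesis
  proof (cases "b y y = 0")
    case True
    have "b x y = 0"
    proof (rule ccontr)
      assume "b x y \<noteq> 0"
      \<comment> \<open>With b y y = 0 the quadratic is affine in t, and this t gives it the value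
        -1.\<close>
      then show False
        using exp[of "- (b x x + 1) / (2 * b x y)"] True by (simp add: field_simps)
    qed
    then show ?thesis using True by simp
  next
    case False
    then have "b y y > 0" using nonneg[of y] by simp
    then show ?thesis
      using exp[of "- b x y / b y y"] by (simp add: field_simps power2_eq_square)
  qed
qed

locale positive_operator =
  fixes A :: "'a::complex_inner \<Rightarrow> 'a"
  assumes positive: "positive_op A"
begin

lemma bounded_linear: "bounded_linear A"
  and scaleC: "A (c *\<^sub>C x) = c *\<^sub>C A x"
  using positive by (simp_all add: positive_op_def bounded_clinear_def)

sublocale bounded_linear A by (rule bounded_linear)

text \<open>The real part is a symmetric real bilinear form with the same seminorm; quadratic
  arguments and real polynomials in an operator only need this form.\<close>

definition semi_inner :: "'a \<Rightarrow> 'a \<Rightarrow> real"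
  where "semi_inner x y = Re (A_inner A x y)"

lemma semi_inner_eq: "semi_inner x y = inner (A x) y"
  by (simp add: semi_inner_def A_inner_def inner_eq_Re_cinner)

lemma semi_inner_commute: "semi_inner x y = semi_inner y x"
  unfolding semi_inner_eq by (subst positive_op_inner[OF positive]) (rule inner_commute)

lemma semi_inner_add_left: "semi_inner (x + y) z = semi_inner x z + semi_inner y z"
  and semi_inner_add_right: "semi_inner z (x + y) = semi_inner z x + semi_inner z y"
  and semi_inner_diff_left: "semi_inner (x - y) z = semi_inner x z - semi_inner y z"
  and semi_inner_diff_right: "semi_inner z (x - y) = semi_inner z x - semi_inner z y"
  and semi_inner_scaleR_left: "semi_inner (a *\<^sub>R x) z = a * semi_inner x z"
  and semi_inner_scaleR_right: "semi_inner z (a *\<^sub>R x) = a * semi_inner z x"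
  and semi_inner_zero_left: "semi_inner 0 x = 0"
  and semi_inner_zero_right: "semi_inner x 0 = 0"
  by (simp_all add: semi_inner_eq add diff scale zero inner_add_left inner_add_right
      inner_diff_left inner_diff_right)

lemmas semi_inner_simps = semi_inner_add_left semi_inner_add_right semi_inner_diff_left
  semi_inner_diff_right semi_inner_scaleR_left semi_inner_scaleR_right semi_inner_zero_left
  semi_inner_zero_right

lemma semi_inner_nonneg: "semi_inner x x \<ge> 0"
  using positive by (simp add: semi_inner_def A_inner_def positive_op_def complex_nonneg_Reals_iff)

lemma A_norm_square: "(A_norm A x)\<^sup>2 = semi_inner x x"
  using semi_inner_nonneg by (simp add: A_norm_def semi_inner_def)

lemma A_norm_nonneg: "A_norm A x \<ge> 0"
  using semi_inner_nonneg by (simp add: A_norm_def semi_inner_def)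

lemma A_inner_self: "A_inner A x x = of_real ((A_norm A x)\<^sup>2)"
proof -
  have "A_inner A x x \<in> \<real>"
    using positive nonneg_Reals_subset_Reals by (auto simp: positive_op_def A_inner_def)
  then show ?thesis by (simp add: A_norm_square semi_inner_def complex_is_Real_iff complex_eq_iff)
qed

lemma semi_inner_le: "semi_inner x y \<le> A_norm A x * A_norm A y"
proof -
  have "bilinear semi_inner"
    by (auto simp: bilinear_def linear_iff semi_inner_simps)
  then have "(semi_inner x y)\<^sup>2 \<le> semi_inner x x * semi_inner y y"
    by (rule semidefinite_cauchy_schwarz) (rule semi_inner_commute, rule semi_inner_nonneg)
  then have "(semi_inner x y)\<^sup>2 \<le> (A_norm A x * A_norm A y)\<^sup>2"
    by (simp add: A_norm_square power_mult_distrib)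
  then show ?thesis
    by (rule power2_le_imp_le) (simp add: A_norm_nonneg)
qed

lemma A_inner_scaleC_left: "A_inner A (c *\<^sub>C x) y = c * A_inner A x y"
  by (simp add: A_inner_def scaleC cinner_scaleC_left)

lemma A_norm_scaleC: "A_norm A (c *\<^sub>C x) = cmod c * A_norm A x"
proof -
  have "A_inner A (c *\<^sub>C x) (c *\<^sub>C x) = (c * cnj c) * A_inner A x x"
    by (simp add: A_inner_def scaleC cinner_scaleC_left cinner_scaleC_right)
  also have "\<dots> = of_real ((cmod c)\<^sup>2 * (A_norm A x)\<^sup>2)"
    by (simp only: A_inner_self of_real_mult complex_norm_square)
  finally have "Re (A_inner A (c *\<^sub>C x) (c *\<^sub>C x)) = (cmod c * A_norm A x)\<^sup>2"
    by (simp add: power_mult_distrib)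
  then show ?thesis
    by (simp add: A_norm_def[of A "c *\<^sub>C x"] A_norm_nonneg)
qed

lemma A_norm_scaleR: "A_norm A (a *\<^sub>R x) = \<bar>a\<bar> * A_norm A x"
  using A_norm_scaleC[of "of_real a" x] by (simp add: scaleC_of_real)

lemma A_norm_zero: "A_norm A 0 = 0"
  using A_norm_scaleR[of 0 0] by simp

lemma A_norm_triangle: "A_norm A (x + y) \<le> A_norm A x + A_norm A y"
proof -
  have "(A_norm A (x + y))\<^sup>2 = (A_norm A x)\<^sup>2 + 2 * semi_inner x y + (A_norm A y)\<^sup>2"
    by (simp add: A_norm_square semi_inner_simps semi_inner_commute[of y x])
  also have "\<dots> \<le> (A_norm A x + A_norm A y)\<^sup>2"
    using semi_inner_le[of x y] by (simp add: power2_sum)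
  finally show ?thesis
    by (rule power2_le_imp_le) (simp add: A_norm_nonneg)
qed

lemma A_norm_minus_commute: "A_norm A (x - y) = A_norm A (y - x)"
  using A_norm_scaleR[of "-1" "y - x"] by simp

lemma A_norm_triangle_diff: "A_norm A (x - z) \<le> A_norm A (x - y) + A_norm A (y - z)"
  using A_norm_triangle[of "x - y" "y - z"] by simp

lemma abs_A_norm_diff_le: "\<bar>A_norm A x - A_norm A y\<bar> \<le> A_norm A (x - y)"
  using A_norm_triangle[of "x - y" y] A_norm_triangle[of "y - x" x] A_norm_minus_commute[of x y]
  by simp

lemma cmod_A_inner_le: "cmod (A_inner A x y) \<le> A_norm A x * A_norm A y"
proof (cases "A_inner A x y = 0")
  case True
  then show ?thesis by (simp add: A_norm_nonneg)
next
  case False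
  \<comment> \<open>A unimodular factor rotating \<open>A_inner A x y\<close> onto the nonnegative
    reals, where the real Cauchy-Schwarz inequality applies.\<close>
  define c where "c = cnj (sgn (A_inner A x y))"
  have "c * A_inner A x y = A_inner A x y * cnj (A_inner A x y) / of_real (cmod (A_inner A x y))"
    by (simp add: c_def sgn_eq)
  also have "\<dots> = of_real (cmod (A_inner A x y))"
    using False by (simp add: power2_eq_square flip: complex_norm_square)
  finally have "cmod (A_inner A x y) = Re (c * A_inner A x y)" by simp
  also have "\<dots> = semi_inner (c *\<^sub>C x) y"
    by (simp add: semi_inner_def A_inner_scaleC_left)
  also have "\<dots> \<le> A_norm A (c *\<^sub>C x) * A_norm A y" by (rule semi_inner_le)
  also have "A_norm A (c *\<^sub>C x) = A_norm A x"
    using False by (simp add: A_norm_scaleC c_def norm_sgn)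
  finally show ?thesis .
qed

lemma A_norm_le_norm: "\<exists>K\<ge>0. \<forall>x. A_norm A x \<le> K * norm x"
proof -
  obtain K where K: "\<And>x. norm (A x) \<le> norm x * K" "K \<ge> 0" using nonneg_bounded by blast
  have "A_norm A x \<le> sqrt K * norm x" for x
  proof -
    have "(A_norm A x)\<^sup>2 \<le> norm (A x) * norm x"
      by (simp add: A_norm_square semi_inner_eq norm_cauchy_schwarz)
    also have "\<dots> \<le> norm x * K * norm x" by (intro mult_right_mono K) simp
    finally have "(A_norm A x)\<^sup>2 \<le> (sqrt K * norm x)\<^sup>2"
      using K(2) by (simp add: power_mult_distrib) (simp add: power2_eq_square mult_ac)
    then show ?thesis by (rule power2_le_imp_le) (simp add: K(2))
  qed
  then show ?thesis using K(2) by (intro exI[of _ "sqrt K"]) simp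
qed

(* Krein's trick: |Sx|^2 \<le> |S^2 x| |x| iterated gives |Sx|^(2^n) \<le> |S^(2^n) x| |x|^(2^n-1),
   and the growth of the right-hand side is controlled by the norm of the ambient space. *)
lemma selfadjoint_bounded:
  assumes S: "bounded_linear S" and sa: "\<And>x y. semi_inner (S x) y = semi_inner x (S y)"
  shows "\<exists>C\<ge>0. \<forall>x. A_norm A (S x) \<le> C * A_norm A x"
proof -
  obtain K where K: "K > 0" "\<And>x. norm (S x) \<le> norm x * K"
    using bounded_linear.pos_bounded[OF S] by blast
  obtain K' where K': "K' \<ge> 0" "\<And>x. A_norm A x \<le> K' * norm x" using A_norm_le_norm by blast
  have pow: "norm ((S ^^ n) x) \<le> K ^ n * norm x" for n x
  proof (induction n)
    case (Suc n)
    have "norm ((S ^^ Suc n) x) \<le> norm ((S ^^ n) x) * K" using K(2) by simp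
    also have "\<dots> \<le> (K ^ n * norm x) * K" using Suc K(1) by (intro mult_right_mono) auto
    finally show ?case by (simp add: mult_ac)
  qed simp
  have sa': "semi_inner ((S ^^ n) x) y = semi_inner x ((S ^^ n) y)" for n x y
    by (induction n arbitrary: y) (simp_all add: sa flip: funpow_swap1)
  have dbl: "(A_norm A ((S ^^ n) x))\<^sup>2 \<le> A_norm A x * A_norm A ((S ^^ (2 * n)) x)" for n x
  proof -
    have "(A_norm A ((S ^^ n) x))\<^sup>2 = semi_inner x ((S ^^ (2 * n)) x)"
      by (simp add: A_norm_square sa' mult_2 funpow_add)
    then show ?thesis using semi_inner_le by simp
  qed
  have "A_norm A (S x) \<le> K * A_norm A x" for x
  proof (cases "A_norm A x = 0")
    case True
    then show ?thesis using dbl[of 1 x] by simp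
  next
    case False
    define a where "a = A_norm A x"
    have a: "a > 0" using False A_norm_nonneg[of x] by (simp add: a_def)
    define y where "y = A_norm A (S x) / (a * K)"
    have y0: "y \<ge> 0" using a K by (simp add: y_def A_norm_nonneg)
    have it: "(A_norm A (S x) / a) ^ (2 ^ n) \<le> A_norm A ((S ^^ (2 ^ n)) x) / a" for n
    proof (induction n)
      case (Suc n)
      have "(A_norm A (S x) / a) ^ (2 ^ Suc n) = ((A_norm A (S x) / a) ^ (2 ^ n))\<^sup>2"
        by (simp add: mult.commute flip: power_mult)
      also have "\<dots> \<le> (A_norm A ((S ^^ (2 ^ n)) x) / a)\<^sup>2"
        using Suc a by (intro power_mono) (auto simp: A_norm_nonneg)
      also have "\<dots> \<le> a * A_norm A ((S ^^ (2 * 2 ^ n)) x) / a\<^sup>2"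
        unfolding power_divide using dbl[of "2 ^ n" x] a by (intro divide_right_mono) (auto simp: a_def)
      also have "\<dots> = A_norm A ((S ^^ (2 ^ Suc n)) x) / a"
        using a by (simp add: power2_eq_square)
      finally show ?case .
    qed (simp add: a_def)
    \<comment> \<open>Only exponents 2^n are under control, but for y > 1 they dominate because n
      \<le> 2^n. The factors K^(2^n) cancel since y is normalised by K. A ratio with bounded powers
      is at most 1.\<close>
    have "y ^ n \<le> max 1 (K' * norm x / a)" for n
    proof (cases "y \<le> 1")
      case True
      then show ?thesis using y0 by (simp add: power_le_one le_max_iff_disj)
    next
      case False
      have "y ^ n \<le> y ^ (2 ^ n)"
        using False less_exp[of n] by (intro power_increasing) auto
      also have "\<dots> = (A_norm A (S x) / a) ^ (2 ^ n) / K ^ (2 ^ n)"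
        by (simp add: y_def power_divide power_mult_distrib)
      also have "\<dots> \<le> (A_norm A ((S ^^ (2 ^ n)) x) / a) / K ^ (2 ^ n)"
        using it K by (intro divide_right_mono) auto
      also have "\<dots> \<le> (K' * (K ^ (2 ^ n) * norm x) / a) / K ^ (2 ^ n)"
        using K'(2)[of "(S ^^ (2 ^ n)) x"] mult_left_mono[OF pow[of "2 ^ n" x] K'(1)] K(1) a
        by (intro divide_right_mono) auto
      also have "\<dots> = K' * norm x / a" using K(1) by simp
      finally show ?thesis by simp
    qed
    then have "y \<le> 1" by (meson real_arch_pow not_less)
    then show ?thesis using a K(1) by (simp add: y_def a_def[symmetric] field_simps)
  qed
  then show ?thesis using K(1) by (intro exI[of _ K]) auto
qed

text \<open>The vector v is the reflection of a in the line through e, so it has the seminorm of a.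
  Cauchy-Schwarz for v and b is the claim after rearranging.\<close>

lemma buzano:
  assumes "A_norm A e = 1"
  shows "semi_inner a e * semi_inner e b \<le> (A_norm A a * A_norm A b + semi_inner a b) / 2"
proof -
  define v where "v = (2 * semi_inner a e) *\<^sub>R e - a"
  have e: "semi_inner e e = 1" using assms by (simp flip: A_norm_square)
  have "(A_norm A v)\<^sup>2 = (A_norm A a)\<^sup>2"
    by (simp add: A_norm_square v_def semi_inner_simps e semi_inner_commute[of e a])
  then have "A_norm A v = A_norm A a" by (simp add: A_norm_nonneg power2_eq_iff_nonneg)
  moreover have "semi_inner v b = 2 * (semi_inner a e * semi_inner e b) - semi_inner a b"
    by (simp add: v_def semi_inner_simps)
  ultimately show ?thesis using semi_inner_le[of v b] by simp
qed

end

section \<open>Polynomials in an operator\<close>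

text \<open>Raising k by one multiplies the binomial ratio by (j - k)/(n - k), which is within k/(n
  - k) of j/n. As all factors involved are at most 1 in the relevant range, the errors simply add
  up.\<close>

lemma choose_ratio_approx:
  fixes n j k :: nat
  assumes "k < n" "j \<le> n"
  shows "\<bar>real (j choose k) / real (n choose k) - (real j / real n) ^ k\<bar> \<le> real (k\<^sup>2) / real (n - k)"
  using assms(1)
proof (induction k)
  case (Suc k)
  define u where "u = real (j choose k) / real (n choose k)"
  have kn: "k < n" "real n - real k > 0" "real (n choose k) > 0" "real (n choose Suc k) > 0"
    using Suc.prems by auto
  \<comment> \<open>Subtraction is taken in the reals, so that the identity also covers m < k, where
    both sides vanish.\<close>
  have step: "real (m choose Suc k) * real (Suc k) = real (m choose k) * (real m - real k)" for m
  proof (cases "k \<le> m")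
    case True
    have "(m choose Suc k) * Suc k = (m choose k) * (m - k)"
      using binomial_absorption[of k m] binomial_absorb_comp[of m k] by (simp add: mult.commute)
    then have "real ((m choose Suc k) * Suc k) = real ((m choose k) * (m - k))" by (rule arg_cong)
    then show ?thesis using True by (simp only: of_nat_mult of_nat_diff)
  qed (simp add: binomial_eq_0)
  have u: "0 \<le> u" "u \<le> 1"
    using kn assms(2) by (auto simp: u_def binomial_right_mono)
  have "real (j choose Suc k) / real (n choose Suc k)
      = (real (j choose Suc k) * real (Suc k)) / (real (n choose Suc k) * real (Suc k))"
    by simp
  also have "\<dots> = u * ((real j - real k) / (real n - real k))"
    unfolding step by (simp add: u_def)
  finally have eq: "real (j choose Suc k) / real (n choose Suc k) = u * ((real j - real k) / (real n - real k))" .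
  have "(real j - real k) / (real n - real k) - real j / real n
      = - (real k * (real n - real j) / (real n * (real n - real k)))"
    using kn by (simp add: field_simps)
  also have "\<bar>\<dots>\<bar> \<le> real k / (real n - real k)"
  proof -
    have "real k * (real n - real j) / (real n * (real n - real k)) \<le> real k * real n / (real n * (real n - real k))"
      using kn by (intro divide_right_mono mult_left_mono) auto
    then show ?thesis using kn assms(2) by (simp add: abs_mult)
  qed
  finally have d: "\<bar>(real j - real k) / (real n - real k) - real j / real n\<bar> \<le> real k / (real n - real k)" .
  have "u * ((real j - real k) / (real n - real k)) - (real j / real n) ^ Suc k
      = u * ((real j - real k) / (real n - real k) - real j / real n)
        + (real j / real n) * (u - (real j / real n) ^ k)"
    by (simp add: algebra_simps)
  also have "\<bar>\<dots>\<bar> \<le> 1 * (real k / (real n - real k)) + 1 * (real (k\<^sup>2) / real (n - k))"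
    unfolding abs_mult
    by (intro order_trans[OF abs_triangle_ineq] add_mono; unfold abs_mult; intro mult_mono)
      (use u d Suc.IH kn assms(2) in \<open>auto simp: u_def\<close>)
  also have "\<dots> \<le> (real k + real (k\<^sup>2)) / (real n - real k)"
    using kn by (simp add: add_divide_distrib of_nat_diff)
  \<comment> \<open>Uses k + k^2 \<le> (k + 1)^2 and a smaller denominator, still positive as
    \<open>Suc k < n\<close>.\<close>
  also have "\<dots> \<le> real ((Suc k)\<^sup>2) / real (n - Suc k)"
    using Suc.prems by (intro frac_le) (auto simp: power2_eq_square of_nat_diff algebra_simps)
  finally show ?case unfolding eq .
qed simp

(* Bernstein: L extends to a positive functional because the Bernstein coefficients of a monomial
   t^k at level n approach the values (j/n)^k. *)
lemma positive_functional_unit: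
  fixes L :: "real poly \<Rightarrow> real"
  assumes add: "\<And>p q. L (p + q) = L p + L q" and smult: "\<And>c p. L (smult c p) = c * L p"
    and pos: "\<And>i j. L ([:0, 1:] ^ i * [:1, -1:] ^ j) \<ge> 0"
    and p: "\<And>t. 0 \<le> t \<Longrightarrow> t \<le> 1 \<Longrightarrow> poly p t \<ge> 0"
  shows "L p \<ge> 0"
proof -
  have L0: "L 0 = 0" using smult[of 0 0] by simp
  have sum: "L (\<Sum>i\<in>I. f i) = (\<Sum>i\<in>I. L (f i))" if "finite I" for I :: "nat set" and f
    using that by (induction I) (simp_all add: L0 add)
  let ?x = "[:0, 1:] :: real poly" and ?y = "[:1, -1:] :: real poly"
  \<comment> \<open>The value of L at a Bernstein basis polynomial, read as a mass at the node j/n.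
    The masses are nonnegative with total \<open>L 1\<close> at every level n.\<close>
  define w where "w n j = real (n choose j) * L (?x ^ j * ?y ^ (n - j))" for n j
  have w0: "w n j \<ge> 0" for n j by (simp add: w_def pos)
  have mon: "L (?x ^ k) = (\<Sum>j\<le>n. w n j * (real (j choose k) / real (n choose k)))"
    if "k \<le> n" for k n
  proof -
    have "?x + ?y = 1" by (simp add: one_pCons)
    \<comment> \<open>Multiplying by 1 = (t + (1 - t))^(n - k) raises the monomial t^k to level n,
      exposing its Bernstein coefficients.\<close>
    then have "?x ^ k = ?x ^ k * (?x + ?y) ^ (n - k)" by (simp only: power_one mult_1_right)
    also have "\<dots> = (\<Sum>i\<le>n - k. smult (real (n - k choose i)) (?x ^ (i + k) * ?y ^ (n - k - i)))"
      unfolding binomial_ring sum_distrib_left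
      by (intro sum.cong refl) (simp add: power_add of_nat_poly mult_ac)
    finally have "L (?x ^ k) = (\<Sum>i\<le>n - k. real (n - k choose i) * L (?x ^ (i + k) * ?y ^ (n - k - i)))"
      by (simp only: sum[OF finite_atMost] smult)
    also have "\<dots> = (\<Sum>j\<in>{k..n}. real (n - k choose (j - k)) * L (?x ^ j * ?y ^ (n - j)))"
      by (rule sum.reindex_bij_witness[of _ "\<lambda>j. j - k" "\<lambda>i. i + k"])
        (use that in \<open>auto simp: add.commute\<close>)
    also have "\<dots> = (\<Sum>j\<in>{k..n}. w n j * (real (j choose k) / real (n choose k)))"
    proof (rule sum.cong[OF refl])
      fix j assume "j \<in> {k..n}"
      then have "real (n choose j) * real (j choose k) = real (n choose k) * real (n - k choose (j - k))"
        using choose_mult[of k j n] by (simp flip: of_nat_mult)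
      moreover have "real (n choose k) > 0" using that by simp
      ultimately have "real (n - k choose (j - k)) = real (n choose j) * (real (j choose k) / real (n choose k))"
        by (simp add: field_simps)
      then show "real (n - k choose (j - k)) * L (?x ^ j * ?y ^ (n - j)) = w n j * (real (j choose k) / real (n choose k))"
        by (simp add: w_def)
    qed
    also have "\<dots> = (\<Sum>j\<le>n. w n j * (real (j choose k) / real (n choose k)))"
      by (rule sum.mono_neutral_left) (auto simp: not_le)
    finally show ?thesis .
  qed
  have W: "(\<Sum>j\<le>n. w n j) = L 1" for n using mon[of 0 n] by simp
  let ?d = "degree p"
  \<comment> \<open>Bounds, uniformly over the nodes, how far the Bernstein coefficients of p are
    from the values of p. It tends to 0 because the degree is fixed.\<close>
  define \<delta> where "\<delta> n = (\<Sum>k\<le>?d. \<bar>coeff p k\<bar> * (real (k\<^sup>2) / real (n - k)))" for n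
  have low: "- (\<delta> n * L 1) \<le> L p" if n: "n > ?d" for n
  proof -
    have "L p = L (\<Sum>k\<le>?d. smult (coeff p k) (?x ^ k))"
      by (subst poly_as_sum_of_monoms[of p, symmetric]) (simp add: monom_altdef)
    also have "\<dots> = (\<Sum>k\<le>?d. coeff p k * (\<Sum>j\<le>n. w n j * (real (j choose k) / real (n choose k))))"
      using n by (simp add: sum smult mon[of _ n])
    also have "\<dots> = (\<Sum>j\<le>n. w n j * (\<Sum>k\<le>?d. coeff p k * (real (j choose k) / real (n choose k))))"
      by (subst (1 2) sum_distrib_left, subst sum.swap) (simp add: mult_ac)
    also have "\<dots> \<ge> (\<Sum>j\<le>n. w n j * (- \<delta> n))"
    proof (intro sum_mono mult_left_mono w0)
      fix j assume "j \<in> {..n}"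
      then have j: "j \<le> n" by simp
      have "0 \<le> poly p (real j / real n)" using j by (intro p) (auto simp: divide_le_eq_1)
      then have "- \<delta> n \<le> (\<Sum>k\<le>?d. coeff p k * (real j / real n) ^ k) - \<delta> n"
        by (simp add: poly_altdef)
      also have "\<dots> = (\<Sum>k\<le>?d. coeff p k * (real j / real n) ^ k - \<bar>coeff p k\<bar> * (real (k\<^sup>2) / real (n - k)))"
        by (simp add: \<delta>_def sum_subtractf)
      also have "\<dots> \<le> (\<Sum>k\<le>?d. coeff p k * (real (j choose k) / real (n choose k)))"
      proof (rule sum_mono)
        fix k assume "k \<in> {..?d}"
        then have "\<bar>real (j choose k) / real (n choose k) - (real j / real n) ^ k\<bar> \<le> real (k\<^sup>2) / real (n - k)"
          using n j by (intro choose_ratio_approx) auto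
        then have "\<bar>coeff p k\<bar> * \<bar>(real j / real n) ^ k - real (j choose k) / real (n choose k)\<bar>
            \<le> \<bar>coeff p k\<bar> * (real (k\<^sup>2) / real (n - k))"
          by (intro mult_left_mono) (auto simp: abs_minus_commute)
        moreover have "coeff p k * ((real j / real n) ^ k - real (j choose k) / real (n choose k))
            \<le> \<bar>coeff p k\<bar> * \<bar>(real j / real n) ^ k - real (j choose k) / real (n choose k)\<bar>"
          by (metis abs_ge_self abs_mult)
        ultimately have "coeff p k * ((real j / real n) ^ k - real (j choose k) / real (n choose k))
            \<le> \<bar>coeff p k\<bar> * (real (k\<^sup>2) / real (n - k))"
          by (rule order_trans[rotated])
        then show "coeff p k * (real j / real n) ^ k - \<bar>coeff p k\<bar> * (real (k\<^sup>2) / real (n - k))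
            \<le> coeff p k * (real (j choose k) / real (n choose k))"
          unfolding right_diff_distrib diff_le_eq by (simp only: add.commute)
      qed
      finally show "- \<delta> n \<le> (\<Sum>k\<le>?d. coeff p k * (real (j choose k) / real (n choose k)))" .
    qed
    finally show ?thesis unfolding sum_distrib_right[symmetric] W by (simp add: mult.commute)
  qed
  have lim: "\<delta> \<longlonglongrightarrow> 0"
  proof -
    have inv: "(\<lambda>n. real (k\<^sup>2) / real (n - k)) \<longlonglongrightarrow> 0" for k
    proof (rule LIMSEQ_offset[where k = k])
      show "(\<lambda>n. real (k\<^sup>2) / real (n + k - k)) \<longlonglongrightarrow> 0"
        by (simp add: lim_const_over_n)
    qed
    have "\<delta> \<longlonglongrightarrow> (\<Sum>k\<le>?d. \<bar>coeff p k\<bar> * 0)"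
      unfolding \<delta>_def by (intro tendsto_sum tendsto_mult tendsto_const inv)
    then show ?thesis by simp
  qed
  have "(\<lambda>n. - (\<delta> n * L 1)) \<longlonglongrightarrow> - (0 * L 1)" by (intro tendsto_intros lim)
  then have "- (0 * L 1) \<le> L p"
    by (rule tendsto_upperbound) (auto intro!: eventually_sequentiallyI[of "Suc ?d"] low)
  then show ?thesis by simp
qed

text \<open>The substitution t = M s reduces to the unit interval; each generator t or M - t picks
  up only a positive factor 1/M.\<close>

lemma positive_functional:
  fixes L :: "real poly \<Rightarrow> real"
  assumes add: "\<And>p q. L (p + q) = L p + L q" and smult: "\<And>c p. L (smult c p) = c * L p"
    and pos: "\<And>i j. L ([:0, 1:] ^ i * [:M, -1:] ^ j) \<ge> 0" and M: "M > 0"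
    and p: "\<And>t. 0 \<le> t \<Longrightarrow> t \<le> M \<Longrightarrow> poly p t \<ge> 0"
  shows "L p \<ge> 0"
proof -
  define L' where "L' q = L (pcompose q [:0, 1 / M:])" for q
  have pow: "pcompose (q ^ n) r = pcompose q r ^ n" for q r :: "real poly" and n
    by (induction n) (simp_all add: pcompose_mult pcompose_1)
  have "L' (pcompose p [:0, M:]) \<ge> 0"
  proof (rule positive_functional_unit)
    show "L' (q + r) = L' q + L' r" for q r by (simp add: L'_def pcompose_add add)
    show "L' (Polynomial.smult c q) = c * L' q" for c q by (simp add: L'_def pcompose_smult smult)
    show "L' ([:0, 1:] ^ i * [:1, -1:] ^ j) \<ge> 0" for i j
    proof -
      have "pcompose [:0, 1:] [:0, 1 / M:] = Polynomial.smult (1 / M) [:0, 1:]"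
        and "pcompose [:1, -1:] [:0, 1 / M:] = Polynomial.smult (1 / M) [:M, -1:]"
        using M by (simp_all add: pcompose_pCons)
      then have "L' ([:0, 1:] ^ i * [:1, -1:] ^ j)
          = (1 / M) ^ i * ((1 / M) ^ j * L ([:0, 1:] ^ i * [:M, -1:] ^ j))"
        unfolding L'_def by (simp only: pcompose_mult pow smult_power mult_smult_left
            mult_smult_right smult mult_ac)
      then show ?thesis using M pos by simp
    qed
    show "0 \<le> t \<Longrightarrow> t \<le> 1 \<Longrightarrow> poly (pcompose p [:0, M:]) t \<ge> 0" for t
      using M by (auto simp: poly_pcompose intro!: p mult_le_one simp: mult_left_le mult.commute)
  qed
  moreover have "pcompose (pcompose p [:0, M:]) [:0, 1 / M:] = p"
    using M by (simp add: pcompose_assoc[symmetric] pcompose_pCons pcompose_idR)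
  ultimately show ?thesis by (simp add: L'_def)
qed

section \<open>Polynomials in a linear operator on H\<close>

text \<open>The same Horner recursion as \<open>compl_poly\<close>, but on vectors, so that the
  latter can be computed on representatives.\<close>

definition op_poly :: "real poly \<Rightarrow> ('a::real_vector \<Rightarrow> 'a) \<Rightarrow> 'a \<Rightarrow> 'a" where
  "op_poly p S = fold_coeffs (\<lambda>a G x. a *\<^sub>R x + S (G x)) p (\<lambda>x. 0)"

lemma op_poly_0: "op_poly 0 S x = 0"
  by (simp add: op_poly_def)

context
  fixes S :: "'a::real_vector \<Rightarrow> 'a"
  assumes S: "linear S"
begin

lemma op_poly_pCons: "op_poly (pCons a p) S x = a *\<^sub>R x + S (op_poly p S x)"
  by (cases "a = 0 \<and> p = 0") (auto simp: op_poly_def linear_0[OF S])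

lemma op_poly_add: "op_poly (p + q) S x = op_poly p S x + op_poly q S x"
  by (induction p q rule: poly_induct2)
    (simp_all add: op_poly_0 op_poly_pCons linear_add[OF S] scaleR_add_left)

lemma op_poly_smult: "op_poly (smult c p) S x = c *\<^sub>R op_poly p S x"
  by (induction p)
    (simp_all add: op_poly_0 op_poly_pCons linear_scale[OF S] scaleR_add_right)

lemma op_poly_minus: "op_poly (p - q) S x = op_poly p S x - op_poly q S x"
  using op_poly_add[of p "- q"] op_poly_smult[of "-1" q] by simp

lemma op_poly_mult: "op_poly (p * q) S x = op_poly p S (op_poly q S x)"
  by (induction p) (simp_all add: op_poly_0 op_poly_pCons op_poly_add op_poly_smult)

lemma op_poly_const: "op_poly [:a:] S x = a *\<^sub>R x"
  by (simp add: op_poly_pCons op_poly_0 linear_0[OF S])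

lemma op_poly_monom1: "op_poly [:0, 1:] S x = S x"
  by (simp add: op_poly_pCons op_poly_0 linear_0[OF S])

lemma linear_op_poly: "linear (op_poly p S)"
proof (induction p)
  case 0
  then show ?case by (auto simp: linear_iff op_poly_0)
next
  case (pCons a p)
  then show ?case
    by (auto simp: linear_iff op_poly_pCons linear_add[OF S] linear_scale[OF S] algebra_simps)
qed

lemma op_poly_commute: "op_poly p S (S x) = S (op_poly p S x)"
  by (induction p)
    (simp_all add: op_poly_0 op_poly_pCons linear_0[OF S] linear_add[OF S] linear_scale[OF S])

end

section \<open>The completion\<close>

context positive_operator
begin

lemma A_CauchyE:
  assumes "X \<in> A_Cauchy A" "e > 0"
  obtains N where "\<And>m n. m \<ge> N \<Longrightarrow> n \<ge> N \<Longrightarrow> A_norm A (X m - X n) < e"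
proof -
  have "\<exists>N. \<forall>m\<ge>N. \<forall>n\<ge>N. A_norm A (X m - X n) < e" using assms by (simp add: A_Cauchy_def)
  then show ?thesis using that by blast
qed

lemma A_Cauchy_const: "(\<lambda>_. x) \<in> A_Cauchy A"
  by (simp add: A_Cauchy_def A_norm_zero)

lemma A_Cauchy_add:
  assumes "X \<in> A_Cauchy A" "Y \<in> A_Cauchy A"
  shows "(\<lambda>n. X n + Y n) \<in> A_Cauchy A"
  unfolding A_Cauchy_def
proof safe
  fix e :: real assume "e > 0"
  then have "e / 2 > 0" by simp
  obtain M where M: "\<And>m n. m \<ge> M \<Longrightarrow> n \<ge> M \<Longrightarrow> A_norm A (X m - X n) < e / 2"
    using A_CauchyE[OF assms(1) \<open>e / 2 > 0\<close>] by blast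
  obtain N where N: "\<And>m n. m \<ge> N \<Longrightarrow> n \<ge> N \<Longrightarrow> A_norm A (Y m - Y n) < e / 2"
    using A_CauchyE[OF assms(2) \<open>e / 2 > 0\<close>] by blast
  have "A_norm A (X m + Y m - (X n + Y n)) < e" if "m \<ge> max M N" "n \<ge> max M N" for m n
  proof -
    have eq: "X m + Y m - (X n + Y n) = (X m - X n) + (Y m - Y n)" by simp
    have "A_norm A (X m - X n) < e / 2" "A_norm A (Y m - Y n) < e / 2" 
      using that by (auto intro!: M N simp del: less_divide_eq_numeral1)
    then show ?thesis
      unfolding eq using A_norm_triangle[of "X m - X n" "Y m - Y n"] by linarith
  qed
  then show "\<exists>M. \<forall>m\<ge>M. \<forall>n\<ge>M. A_norm A (X m + Y m - (X n + Y n)) < e" by blast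
qed

text \<open>Common source for scalar multiples, for S and for polynomials in S, which are all
  additive and bounded in the seminorm.\<close>

lemma A_Cauchy_bounded_map:
  assumes X: "X \<in> A_Cauchy A" and F: "\<And>x y. F x - F y = F (x - y)"
    and C: "\<And>x. A_norm A (F x) \<le> C * A_norm A x"
  shows "(\<lambda>n. F (X n)) \<in> A_Cauchy A"
  unfolding A_Cauchy_def
proof safe
  fix e :: real assume e: "e > 0"
  have C1: "\<bar>C\<bar> + 1 > 0" by simp
  then have e': "e / (\<bar>C\<bar> + 1) > 0" using e by simp
  obtain M where M: "\<And>m n. m \<ge> M \<Longrightarrow> n \<ge> M \<Longrightarrow> A_norm A (X m - X n) < e / (\<bar>C\<bar> + 1)"
    using A_CauchyE[OF X e'] by blast
  have "A_norm A (F (X m) - F (X n)) < e" if "m \<ge> M" "n \<ge> M" for m n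
  proof -
    have "A_norm A (F (X m) - F (X n)) \<le> C * A_norm A (X m - X n)" by (simp add: F C)
    also have "\<dots> \<le> (\<bar>C\<bar> + 1) * A_norm A (X m - X n)"
      by (intro mult_right_mono) (auto simp: A_norm_nonneg)
    also have "\<dots> < e" using M[OF that] C1 by (simp add: pos_less_divide_eq mult.commute)
    finally show ?thesis .
  qed
  then show "\<exists>M. \<forall>m\<ge>M. \<forall>n\<ge>M. A_norm A (F (X m) - F (X n)) < e" by blast
qed

lemma A_Cauchy_scaleC: "X \<in> A_Cauchy A \<Longrightarrow> (\<lambda>n. c *\<^sub>C X n) \<in> A_Cauchy A"
  by (rule A_Cauchy_bounded_map[where C = "cmod c"])
    (simp_all add: scaleC_diff_right A_norm_scaleC)

lemma A_Cauchy_diff: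
  "X \<in> A_Cauchy A \<Longrightarrow> Y \<in> A_Cauchy A \<Longrightarrow> (\<lambda>n. X n - Y n) \<in> A_Cauchy A"
  using A_Cauchy_add[of X "\<lambda>n. (-1) *\<^sub>C Y n"] A_Cauchy_scaleC[of Y "-1"]
  by (simp add: scaleC_minus_one)

lemma A_norm_convergent:
  assumes "X \<in> A_Cauchy A"
  obtains a where "(\<lambda>n. A_norm A (X n)) \<longlonglongrightarrow> a"
proof -
  have "Cauchy (\<lambda>n. A_norm A (X n))"
  proof (rule metric_CauchyI)
    fix e :: real assume "e > 0"
    then obtain M where "\<And>m n. m \<ge> M \<Longrightarrow> n \<ge> M \<Longrightarrow> A_norm A (X m - X n) < e"
      using A_CauchyE[OF assms] by blast
    then show "\<exists>M. \<forall>m\<ge>M. \<forall>n\<ge>M. dist (A_norm A (X m)) (A_norm A (X n)) < e"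
      unfolding dist_real_def by (meson abs_A_norm_diff_le order_le_less_trans)
  qed
  then show ?thesis using that Cauchy_convergent convergentD by blast
qed

lemma tendsto_A_norm_diff:
  assumes "(\<lambda>n. A_norm A (X n - Y n)) \<longlonglongrightarrow> 0" "(\<lambda>n. A_norm A (X n)) \<longlonglongrightarrow> a"
  shows "(\<lambda>n. A_norm A (Y n)) \<longlonglongrightarrow> a"
proof -
  have "(\<lambda>n. A_norm A (X n) - A_norm A (Y n)) \<longlonglongrightarrow> 0"
    by (rule Lim_null_comparison[OF _ assms(1)]) (simp add: abs_A_norm_diff_le)
  from tendsto_diff[OF assms(2) this] show ?thesis by simp
qed

lemma equiv_A_equiv: "equiv (A_Cauchy A) (A_equiv A)"
proof (rule equivI)
  show "A_equiv A \<subseteq> A_Cauchy A \<times> A_Cauchy A" by (auto simp: A_equiv_def)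
  show "refl_on (A_Cauchy A) (A_equiv A)"
    by (auto simp: refl_on_def A_equiv_def A_norm_zero)
  show "sym (A_equiv A)"
    by (auto simp: sym_def A_equiv_def A_norm_minus_commute)
  show "trans (A_equiv A)"
  proof (rule transI)
    fix X Y Z assume "(X, Y) \<in> A_equiv A" "(Y, Z) \<in> A_equiv A"
    then have *: "X \<in> A_Cauchy A" "Z \<in> A_Cauchy A"
      "(\<lambda>n. A_norm A (X n - Y n)) \<longlonglongrightarrow> 0" "(\<lambda>n. A_norm A (Y n - Z n)) \<longlonglongrightarrow> 0"
      by (auto simp: A_equiv_def)
    have "(\<lambda>n. A_norm A (X n - Y n) + A_norm A (Y n - Z n)) \<longlonglongrightarrow> 0"
      using tendsto_add[OF *(3,4)] by simp
    then have "(\<lambda>n. A_norm A (X n - Z n)) \<longlonglongrightarrow> 0"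
      by (rule Lim_null_comparison[rotated])
        (simp add: A_norm_nonneg A_norm_triangle_diff)
    then show "(X, Z) \<in> A_equiv A" using * by (simp add: A_equiv_def)
  qed
qed

lemma A_class_eqI:
  assumes "X \<in> A_Cauchy A" "Y \<in> A_Cauchy A" "(\<lambda>n. A_norm A (X n - Y n)) \<longlonglongrightarrow> 0"
  shows "A_class A X = A_class A Y"
  unfolding A_class_def
  using assms by (intro equiv_class_eq[OF equiv_A_equiv]) (simp add: A_equiv_def)

lemma mem_A_class:
  assumes "Y \<in> A_class A X"
  shows "Y \<in> A_Cauchy A" "(\<lambda>n. A_norm A (X n - Y n)) \<longlonglongrightarrow> 0"
  using assms by (simp_all add: A_class_def A_equiv_def)

lemma A_class_self: "X \<in> A_Cauchy A \<Longrightarrow> X \<in> A_class A X"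
  by (simp add: A_class_def A_equiv_def A_norm_zero)

lemma A_class_in_compl: "X \<in> A_Cauchy A \<Longrightarrow> A_class A X \<in> A_compl A"
  by (simp add: A_class_def A_compl_def quotientI)

lemma A_compl_cases:
  assumes "u \<in> A_compl A"
  obtains X where "X \<in> A_Cauchy A" "u = A_class A X"
  using assms by (auto simp: A_compl_def A_class_def elim: quotientE)

lemma compl_add_class:
  assumes X: "X \<in> A_Cauchy A" and Y: "Y \<in> A_Cauchy A"
  shows "compl_add A (A_class A X) (A_class A Y) = A_class A (\<lambda>n. X n + Y n)"
proof -
  have "A_class A (\<lambda>n. X' n + Y' n) = A_class A (\<lambda>n. X n + Y n)"
    if "X' \<in> A_class A X" "Y' \<in> A_class A Y" for X' Y'
  proof (rule A_class_eqI)
    note * = mem_A_class[OF that(1)] mem_A_class[OF that(2)]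
    show "(\<lambda>n. X' n + Y' n) \<in> A_Cauchy A" "(\<lambda>n. X n + Y n) \<in> A_Cauchy A"
      using * X Y by (auto intro: A_Cauchy_add)
    have "(\<lambda>n. A_norm A (X n - X' n) + A_norm A (Y n - Y' n)) \<longlonglongrightarrow> 0"
      using tendsto_add[OF *(2,4)] by simp
    then show "(\<lambda>n. A_norm A (X' n + Y' n - (X n + Y n))) \<longlonglongrightarrow> 0"
    proof (rule Lim_null_comparison[rotated], intro always_eventually allI)
      fix n
      have eq: "X' n + Y' n - (X n + Y n) = (X' n - X n) + (Y' n - Y n)" by simp
      show "norm (A_norm A (X' n + Y' n - (X n + Y n)))
          \<le> A_norm A (X n - X' n) + A_norm A (Y n - Y' n)"
        unfolding eq using A_norm_triangle[of "X' n - X n" "Y' n - Y n"]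
        by (simp only: real_norm_def abs_of_nonneg[OF A_norm_nonneg] A_norm_minus_commute[of "X n"]
            A_norm_minus_commute[of "Y n"])
    qed
  qed
  then have "(\<Union>Y'\<in>A_class A Y. A_class A (\<lambda>n. X' n + Y' n)) = A_class A (\<lambda>n. X n + Y n)"
    if "X' \<in> A_class A X" for X'
    using that A_class_self[OF Y] by (intro UN_constant_eq) auto
  then show ?thesis
    unfolding compl_add_def using A_class_self[OF X] by (intro UN_constant_eq) auto
qed

text \<open>Two representatives differ by a null sequence, which F keeps null, so the union is one
  of a constant family. This evaluates both \<open>compl_scale\<close> and
  \<open>compl_lift\<close>.\<close>

lemma bounded_map_class:
  assumes X: "X \<in> A_Cauchy A" and F: "\<And>x y. F x - F y = F (x - y)"
    and C: "\<And>x. A_norm A (F x) \<le> C * A_norm A x"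
  shows "(\<Union>X'\<in>A_class A X. A_class A (\<lambda>n. F (X' n))) = A_class A (\<lambda>n. F (X n))"
proof (rule UN_constant_eq[OF A_class_self[OF X]], rule ballI, rule A_class_eqI)
  fix X' assume "X' \<in> A_class A X"
  note * = mem_A_class[OF this]
  show "(\<lambda>n. F (X' n)) \<in> A_Cauchy A" "(\<lambda>n. F (X n)) \<in> A_Cauchy A"
    using A_Cauchy_bounded_map[OF _ F C] * X by auto
  have "(\<lambda>n. C * A_norm A (X n - X' n)) \<longlonglongrightarrow> 0"
    using tendsto_mult_left[OF *(2), of C] by simp
  then show "(\<lambda>n. A_norm A (F (X' n) - F (X n))) \<longlonglongrightarrow> 0"
  proof (rule Lim_null_comparison[rotated], intro always_eventually allI)
    show "norm (A_norm A (F (X' n) - F (X n))) \<le> C * A_norm A (X n - X' n)" for n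
      using C[of "X' n - X n"] by (simp add: A_norm_nonneg A_norm_minus_commute[of "X n"] F)
  qed
qed

lemma compl_scale_class:
  "X \<in> A_Cauchy A \<Longrightarrow> compl_scale A c (A_class A X) = A_class A (\<lambda>n. c *\<^sub>C X n)"
  unfolding compl_scale_def
  by (rule bounded_map_class[where C = "cmod c"]) (simp_all add: scaleC_diff_right A_norm_scaleC)

lemma compl_diff_class:
  assumes "X \<in> A_Cauchy A" "Y \<in> A_Cauchy A"
  shows "compl_diff A (A_class A X) (A_class A Y) = A_class A (\<lambda>n. X n - Y n)"
  using assms A_Cauchy_scaleC[of Y "-1"]
  by (simp add: compl_diff_def compl_scale_class compl_add_class scaleC_minus_one)

text \<open>\<open>compl_inner\<close> is a description over some pair of representatives; it
  denotes because every pair from the class gives the same limit a^2.\<close>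

lemma compl_norm_class:
  assumes X: "X \<in> A_Cauchy A" and a: "(\<lambda>n. A_norm A (X n)) \<longlonglongrightarrow> a"
  shows "compl_norm A (A_class A X) = a"
proof -
  have lim: "(\<lambda>n. A_inner A (Y n) (Z n)) \<longlonglongrightarrow> of_real (a\<^sup>2)"
    if "Y \<in> A_class A X" "Z \<in> A_class A X" for Y Z
  proof -
    note Y = mem_A_class[OF that(1)] and Z = mem_A_class[OF that(2)]
    have aZ: "(\<lambda>n. A_norm A (Z n)) \<longlonglongrightarrow> a" by (rule tendsto_A_norm_diff[OF Z(2) a])
    have "(\<lambda>n. A_norm A (X n - Y n) * A_norm A (Z n) + A_norm A (X n) * A_norm A (X n - Z n))
        \<longlonglongrightarrow> 0 * a + a * 0"
      by (intro tendsto_intros Y Z a aZ)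
    then have "(\<lambda>n. A_norm A (X n - Y n) * A_norm A (Z n) + A_norm A (X n) * A_norm A (X n - Z n)) \<longlonglongrightarrow> 0"
      by simp
    then have "(\<lambda>n. A_inner A (X n) (X n) - A_inner A (Y n) (Z n)) \<longlonglongrightarrow> 0"
    proof (rule Lim_null_comparison[rotated], intro always_eventually allI)
      fix n
      have "A_inner A (X n) (X n) - A_inner A (Y n) (Z n)
          = A_inner A (X n - Y n) (Z n) + A_inner A (X n) (X n - Z n)"
        by (simp add: A_inner_def diff cinner_diff_left cinner_diff_right)
      also have "cmod \<dots> \<le> A_norm A (X n - Y n) * A_norm A (Z n) + A_norm A (X n) * A_norm A (X n - Z n)"
        by (intro order_trans[OF norm_triangle_ineq] add_mono cmod_A_inner_le)
      finally show "cmod (A_inner A (X n) (X n) - A_inner A (Y n) (Z n))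
          \<le> A_norm A (X n - Y n) * A_norm A (Z n) + A_norm A (X n) * A_norm A (X n - Z n)" .
    qed
    moreover have "(\<lambda>n. A_inner A (X n) (X n)) \<longlonglongrightarrow> of_real (a\<^sup>2)"
      unfolding A_inner_self by (intro tendsto_intros a)
    ultimately show ?thesis using tendsto_diff[of _ "of_real (a\<^sup>2)" sequentially _ 0] by fastforce
  qed
  have "compl_inner A (A_class A X) (A_class A X) = of_real (a\<^sup>2)"
    unfolding compl_inner_def
    using lim A_class_self[OF X] by (intro the_equality) (blast, metis LIMSEQ_unique)
  moreover have "a \<ge> 0" using a A_norm_nonneg by (intro LIMSEQ_le_const[OF a]) auto
  ultimately show ?thesis by (simp add: compl_norm_def)
qed

lemma A_norm_tendsto_compl_norm:
  assumes X: "X \<in> A_Cauchy A"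
  shows "(\<lambda>n. A_norm A (X n)) \<longlonglongrightarrow> compl_norm A (A_class A X)"
proof -
  obtain a where "(\<lambda>n. A_norm A (X n)) \<longlonglongrightarrow> a" by (rule A_norm_convergent[OF X])
  then show ?thesis using compl_norm_class[OF X] by simp
qed

lemma compl_norm_const: "compl_norm A (A_class A (\<lambda>_. x)) = A_norm A x"
  by (intro compl_norm_class A_Cauchy_const tendsto_const)

lemma compl_norm_nonneg: "u \<in> A_compl A \<Longrightarrow> compl_norm A u \<ge> 0"
  by (erule A_compl_cases) (use A_norm_nonneg LIMSEQ_le_const[OF A_norm_tendsto_compl_norm] in blast)

text \<open>The constant C serves only to bound the set above, without which its supremum in
  \<open>compl_opnorm\<close> would carry no information.\<close>

lemma compl_opnorm_upper:
  assumes "\<And>u. u \<in> A_compl A \<Longrightarrow> compl_norm A (F u) \<le> C * compl_norm A u" "C \<ge> 0"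
    and "u \<in> A_compl A" "compl_norm A u \<le> 1"
  shows "compl_norm A (F u) \<le> compl_opnorm A F"
  unfolding compl_opnorm_def
proof (rule cSup_upper)
  show "compl_norm A (F u) \<in> {compl_norm A (F u) |u. u \<in> A_compl A \<and> compl_norm A u \<le> 1}"
    using assms by blast
  have "compl_norm A (F v) \<le> C" if "v \<in> A_compl A" "compl_norm A v \<le> 1" for v
    using assms(1)[OF that(1)] mult_left_mono[OF that(2) assms(2)] by simp
  then show "bdd_above {compl_norm A (F u) |u. u \<in> A_compl A \<and> compl_norm A u \<le> 1}"
    by (intro bdd_aboveI[of _ C]) blast
qed

end

section \<open>Positive operators for the semi-inner product and their polynomials\<close>

locale A_positive_operator = positive_operator A for A :: "'a::complex_inner \<Rightarrow> 'a" +
  fixes S :: "'a \<Rightarrow> 'a"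
  assumes bounded_linear_S: "bounded_linear S"
    and selfadjoint: "semi_inner (S x) y = semi_inner x (S y)"
    and semi_inner_S_nonneg: "semi_inner (S x) x \<ge> 0"
begin

lemma linear_S: "linear S"
  using bounded_linear_S by (rule bounded_linear.linear)

lemma S_diff: "S x - S y = S (x - y)"
  by (simp add: linear_diff[OF linear_S])

lemma S_bounded: obtains C where "C \<ge> 0" "\<And>x. A_norm A (S x) \<le> C * A_norm A x"
  using selfadjoint_bounded[OF bounded_linear_S selfadjoint] by blast

lemma A_Cauchy_S: "X \<in> A_Cauchy A \<Longrightarrow> (\<lambda>n. S (X n)) \<in> A_Cauchy A"
  by (rule S_bounded) (rule A_Cauchy_bounded_map[OF _ S_diff])

lemma compl_lift_class:
  assumes "X \<in> A_Cauchy A"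
  shows "compl_lift A S (A_class A X) = A_class A (\<lambda>n. S (X n))"
proof -
  obtain C where "\<And>x. A_norm A (S x) \<le> C * A_norm A x" using S_bounded by blast
  then show ?thesis
    unfolding compl_lift_def using assms S_diff by (intro bounded_map_class)
qed

lemma compl_norm_compl_lift_le:
  assumes C: "\<And>x. A_norm A (S x) \<le> C * A_norm A x" and u: "u \<in> A_compl A"
  shows "compl_norm A (compl_lift A S u) \<le> C * compl_norm A u"
proof -
  obtain X where X: "X \<in> A_Cauchy A" "u = A_class A X" using A_compl_cases[OF u] .
  have "(\<lambda>n. C * A_norm A (X n)) \<longlonglongrightarrow> C * compl_norm A u"
    unfolding X(2) by (intro tendsto_intros A_norm_tendsto_compl_norm X)
  with A_norm_tendsto_compl_norm[OF A_Cauchy_S[OF X(1)]] show ?thesis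
    unfolding X(2) compl_lift_class[OF X(1)] by (rule LIMSEQ_le) (use C in auto)
qed

text \<open>This is the right endpoint of the interval on which \<open>compl_powr\<close> asks for
  uniform convergence, so estimates on [0, M] itself are required.\<close>

definition M :: real where "M = compl_opnorm A (compl_lift A S)"

text \<open>Constant sequences embed H into the completion with the same seminorm, so a normalised
  vector is admissible in the supremum defining M.\<close>

lemma A_norm_S_le: "A_norm A (S x) \<le> M * A_norm A x"
proof -
  obtain C where C: "C \<ge> 0" "\<And>x. A_norm A (S x) \<le> C * A_norm A x" using S_bounded by blast
  show ?thesis
  proof (cases "A_norm A x = 0")
    case True
    then show ?thesis using C(2)[of x] by simp
  next
    case False
    then have pos: "A_norm A x > 0" using A_norm_nonneg[of x] by simp
    define y where "y = inverse (A_norm A x) *\<^sub>R x"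
    have y: "A_norm A y = 1" using pos by (simp add: y_def A_norm_scaleR)
    have "compl_norm A (compl_lift A S (A_class A (\<lambda>_. y))) \<le> M"
      unfolding M_def
      by (rule compl_opnorm_upper[OF compl_norm_compl_lift_le[OF C(2)] C(1)])
        (use y in \<open>auto simp: compl_norm_const A_class_in_compl A_Cauchy_const\<close>)
    then have "A_norm A (S y) \<le> M"
      by (simp add: compl_lift_class compl_norm_const A_Cauchy_const)
    then show ?thesis
      using pos by (simp add: y_def linear_scale[OF linear_S] A_norm_scaleR field_simps)
  qed
qed

lemma M_nonneg: "M \<ge> 0"
proof -
  obtain C where C: "C \<ge> 0" "\<And>x. A_norm A (S x) \<le> C * A_norm A x" using S_bounded by blast
  have "compl_norm A (compl_lift A S (A_class A (\<lambda>_. 0))) \<le> M"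
    unfolding M_def
    by (rule compl_opnorm_upper[OF compl_norm_compl_lift_le[OF C(2)] C(1)])
      (auto simp: compl_norm_const A_class_in_compl A_Cauchy_const A_norm_zero)
  then show ?thesis
    by (simp add: compl_lift_class compl_norm_const A_Cauchy_const linear_0[OF linear_S] A_norm_zero)
qed

lemma op_poly_selfadjoint: "semi_inner (op_poly p S x) y = semi_inner x (op_poly p S y)"
proof (induction p arbitrary: x y)
  case (pCons a p)
  have "semi_inner (S (op_poly p S x)) y = semi_inner x (S (op_poly p S y))"
    by (simp add: selfadjoint pCons.IH op_poly_commute[OF linear_S])
  then show ?case by (simp add: op_poly_pCons[OF linear_S] semi_inner_simps)
qed (simp add: op_poly_0 semi_inner_simps)

text \<open>Half of a square factor moves to the other argument by selfadjointness; squares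
  therefore never affect positivity.\<close>

lemma op_poly_square: "semi_inner (op_poly (q\<^sup>2 * p) S x) x = semi_inner (op_poly p S (op_poly q S x)) (op_poly q S x)"
proof -
  have "op_poly (q\<^sup>2 * p) S x = op_poly q S (op_poly p S (op_poly q S x))"
    by (simp add: power2_eq_square mult_ac flip: op_poly_mult[OF linear_S])
  then show ?thesis by (simp add: op_poly_selfadjoint)
qed

lemma A_norm_op_poly_square: "(A_norm A (op_poly q S x))\<^sup>2 = semi_inner (op_poly (q\<^sup>2) S x) x"
  using op_poly_square[of q 1 x]
  by (simp add: A_norm_square one_pCons op_poly_const[OF linear_S])

text \<open>This is S^2 \<le> M S, that is, positivity of t(M - t) at S. Cauchy-Schwarz for the form
  <S x, y> at x and S x gives it after cancelling |S x|^2.\<close>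

lemma A_norm_S_square_le: "semi_inner (S x) (S x) \<le> M * semi_inner (S x) x"
proof (cases "semi_inner (S x) (S x) = 0")
  case True
  then show ?thesis using M_nonneg semi_inner_S_nonneg[of x] by simp
next
  case False
  then have pos: "semi_inner (S x) (S x) > 0" using semi_inner_nonneg[of "S x"] by simp
  have "bilinear (\<lambda>x y. semi_inner (S x) y)"
    by (auto simp: bilinear_def linear_iff semi_inner_simps linear_add[OF linear_S] linear_scale[OF linear_S])
  then have "(semi_inner (S x) (S x))\<^sup>2 \<le> semi_inner (S x) x * semi_inner (S (S x)) (S x)"
    by (rule semidefinite_cauchy_schwarz) (metis selfadjoint semi_inner_commute, rule semi_inner_S_nonneg)
  also have "\<dots> \<le> semi_inner (S x) x * (M * semi_inner (S x) (S x))"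
  proof (intro mult_left_mono semi_inner_S_nonneg)
    have "semi_inner (S (S x)) (S x) \<le> A_norm A (S (S x)) * A_norm A (S x)" by (rule semi_inner_le)
    also have "\<dots> \<le> M * A_norm A (S x) * A_norm A (S x)"
      by (intro mult_right_mono A_norm_S_le A_norm_nonneg)
    finally show "semi_inner (S (S x)) (S x) \<le> M * semi_inner (S x) (S x)"
      by (simp add: power2_eq_square flip: A_norm_square)
  qed
  finally show ?thesis using pos by (simp add: power2_eq_square mult.commute)
qed

text \<open>Square factors are split off by \<open>op_poly_square\<close>, leaving exponents 0 or 1,
  hence just the four polynomials 1, t, M - t and t(M - t).\<close>

lemma op_poly_power_nonneg: "semi_inner (op_poly ([:0, 1:] ^ i * [:M, -1:] ^ j) S x) x \<ge> 0"
proof -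
  let ?x = "[:0, 1:] :: real poly" and ?y = "[:M, -1:]"
  have y: "op_poly ?y S x = M *\<^sub>R x - S x" for x
    by (simp add: op_poly_pCons[OF linear_S] op_poly_0 linear_0[OF linear_S] linear_neg[OF linear_S])
  have le: "semi_inner (S x) x \<le> M * semi_inner x x" for x
    using semi_inner_le[of "S x" x] mult_right_mono[OF A_norm_S_le[of x] A_norm_nonneg[of x]]
    by (simp add: power2_eq_square flip: A_norm_square)
  have base: "semi_inner (op_poly (?x ^ k * ?y ^ l) S x) x \<ge> 0" if "k < 2" "l < 2" for k l x
  proof -
    have "k = 0 \<or> k = 1" "l = 0 \<or> l = 1" using that by auto
    moreover have "semi_inner (op_poly (?x * ?y) S x) x \<ge> 0"
      using A_norm_S_square_le[of x]
      by (simp only: op_poly_mult[OF linear_S] op_poly_monom1[OF linear_S] y)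
        (simp add: linear_diff[OF linear_S] linear_scale[OF linear_S] semi_inner_simps selfadjoint)
    moreover have "semi_inner (op_poly ?y S x) x \<ge> 0"
      using le[of x] by (simp only: y) (simp add: semi_inner_simps)
    moreover have "semi_inner (op_poly 1 S x) x \<ge> 0"
      by (simp add: one_pCons op_poly_const[OF linear_S] semi_inner_nonneg)
    moreover have "semi_inner (op_poly ?x S x) x \<ge> 0"
      by (simp only: op_poly_monom1[OF linear_S] semi_inner_S_nonneg)
    ultimately show ?thesis by auto
  qed
  have split: "q ^ k = (q ^ (k div 2))\<^sup>2 * q ^ (k mod 2)" for q :: "real poly" and k
    by (metis div_mult_mod_eq power_add power_mult)
  have "?x ^ i * ?y ^ j = (?x ^ (i div 2) * ?y ^ (j div 2))\<^sup>2 * (?x ^ (i mod 2) * ?y ^ (j mod 2))"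
    by (subst split[of ?x], subst split[of ?y]) (simp only: power_mult_distrib mult_ac)
  then show ?thesis by (simp only: op_poly_square) (rule base; simp)
qed

text \<open>For M > 0 the quadratic form at x is a positive functional on polynomials. For M = 0 the
  operator vanishes in the seminorm and only the constant coefficient counts.\<close>

lemma op_poly_nonneg:
  assumes "\<And>t. 0 \<le> t \<Longrightarrow> t \<le> M \<Longrightarrow> poly p t \<ge> 0"
  shows "semi_inner (op_poly p S x) x \<ge> 0"
proof (cases "M = 0")
  case True
  obtain a q where p: "p = pCons a q" by (cases p)
  have "a \<ge> 0" using assms[of 0] True by (simp add: p)
  moreover have "A_norm A (S y) = 0" for y
    using A_norm_S_le[of y] A_norm_nonneg[of "S y"] True by simp
  \<comment> \<open>Cauchy-Schwarz is available as an upper bound; the sign change in y converts it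
    into a lower bound.\<close>
  then have "semi_inner (S (- y)) x \<le> 0" for y
    using semi_inner_le[of "S (- y)" x] by simp
  then have "semi_inner (S y) x \<ge> 0" for y
    by (simp add: linear_neg[OF linear_S] semi_inner_eq neg)
  ultimately show ?thesis
    by (simp add: p op_poly_pCons[OF linear_S] semi_inner_simps semi_inner_nonneg)
next
  case False
  show ?thesis
    by (rule positive_functional[where L = "\<lambda>p. semi_inner (op_poly p S x) x" and M = M])
      (use False M_nonneg assms op_poly_power_nonneg in
        \<open>auto simp: op_poly_add[OF linear_S] op_poly_smult[OF linear_S] semi_inner_simps\<close>)
qed

text \<open>Positivity of C^2 - p^2 on [0, M] passes to the operator. This is the norm bound of the
  functional calculus, obtained from order alone.\<close>

lemma A_norm_op_poly_le:
  assumes "\<And>t. 0 \<le> t \<Longrightarrow> t \<le> M \<Longrightarrow> \<bar>poly p t\<bar> \<le> C"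
  shows "A_norm A (op_poly p S x) \<le> C * A_norm A x"
proof -
  have C: "C \<ge> 0" using assms[of 0] M_nonneg by simp
  have "0 \<le> semi_inner (op_poly ([:C\<^sup>2:] - p\<^sup>2) S x) x"
  proof (rule op_poly_nonneg)
    fix t assume "0 \<le> t" "t \<le> M"
    then have "\<bar>poly p t\<bar>\<^sup>2 \<le> C\<^sup>2" using assms by (intro power_mono) auto
    then show "0 \<le> poly ([:C\<^sup>2:] - p\<^sup>2) t" by simp
  qed
  then have "semi_inner (op_poly (p\<^sup>2) S x) x \<le> C\<^sup>2 * semi_inner x x"
    by (simp add: op_poly_minus[OF linear_S] op_poly_const[OF linear_S] semi_inner_simps)
  then have "(A_norm A (op_poly p S x))\<^sup>2 \<le> (C * A_norm A x)\<^sup>2"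
    unfolding A_norm_op_poly_square power_mult_distrib A_norm_square[of x] .
  then show ?thesis by (rule power2_le_imp_le) (simp add: C A_norm_nonneg)
qed

lemma op_poly_diff: "op_poly p S x - op_poly p S y = op_poly p S (x - y)"
  by (simp add: linear_diff[OF linear_op_poly[OF linear_S]])

lemma op_poly_bounded: obtains C where "\<And>x. A_norm A (op_poly p S x) \<le> C * A_norm A x"
proof -
  have "compact (poly p ` {0..M})" by (intro compact_continuous_image continuous_intros) auto
  then obtain C where "\<And>t. 0 \<le> t \<Longrightarrow> t \<le> M \<Longrightarrow> \<bar>poly p t\<bar> \<le> C"
    using compact_imp_bounded[of "poly p ` {0..M}"] by (auto simp: bounded_iff) (meson atLeastAtMost_iff)
  then show ?thesis using that A_norm_op_poly_le by blast
qed

lemma A_Cauchy_op_poly: "X \<in> A_Cauchy A \<Longrightarrow> (\<lambda>n. op_poly p S (X n)) \<in> A_Cauchy A"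
  by (rule op_poly_bounded) (rule A_Cauchy_bounded_map[OF _ op_poly_diff])

lemma compl_poly_class:
  assumes X: "X \<in> A_Cauchy A"
  shows "compl_poly A p (compl_lift A S) (A_class A X) = A_class A (\<lambda>n. op_poly p S (X n))"
proof (induction p)
  case 0
  then show ?case by (simp add: compl_poly_def op_poly_def compl_zero_def)
next
  case (pCons a p)
  then have "compl_poly A (pCons a p) (compl_lift A S) (A_class A X)
      = compl_add A (compl_scale A (of_real a) (A_class A X))
          (compl_lift A S (compl_poly A p (compl_lift A S) (A_class A X)))"
    by (auto simp: compl_poly_def)
  also have "\<dots> = A_class A (\<lambda>n. a *\<^sub>R X n + S (op_poly p S (X n)))"
    unfolding pCons.IH
    using X A_Cauchy_scaleC[OF X, of "of_real a"]
    by (simp add: compl_scale_class compl_lift_class compl_add_class A_Cauchy_op_poly A_Cauchy_S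
        scaleC_of_real)
  finally show ?case by (simp add: op_poly_pCons[OF linear_S])
qed

end

section \<open>Powers of positive operators\<close>

lemma weierstrass_real_poly:
  fixes f :: "real \<Rightarrow> real"
  assumes "continuous_on {a..b} f"
  obtains p where "uniform_limit {a..b} (\<lambda>n. poly (p n)) f sequentially"
proof -
  have "\<exists>p. \<forall>t\<in>{a..b}. \<bar>f t - poly p t\<bar> < e" if "e > 0" for e
  proof -
    obtain g where g: "real_polynomial_function g" "\<And>t. t \<in> {a..b} \<Longrightarrow> \<bar>f t - g t\<bar> < e"
      using Stone_Weierstrass_real_polynomial_function[OF compact_Icc assms \<open>e > 0\<close>] by blast
    then obtain c and n :: nat where "g = (\<lambda>t. \<Sum>i\<le>n. c i * t ^ i)"
      by (auto simp: real_polynomial_function_iff_sum)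
    then have "poly (\<Sum>i\<le>n. monom (c i) i) t = g t" for t
      by (simp add: poly_sum poly_monom)
    then show ?thesis using g(2) by metis
  qed
  then have "\<exists>p. \<forall>t\<in>{a..b}. \<bar>f t - poly p t\<bar> < inverse (real (Suc n))" for n by simp
  then obtain p where p: "\<And>n t. t \<in> {a..b} \<Longrightarrow> \<bar>f t - poly (p n) t\<bar> < inverse (real (Suc n))"
    by metis
  have "uniform_limit {a..b} (\<lambda>n. poly (p n)) f sequentially"
  proof (rule uniform_limitI)
    fix e :: real assume "e > 0"
    then have "\<forall>\<^sub>F n in sequentially. inverse (real (Suc n)) < e"
      by (rule order_tendstoD(2)[OF LIMSEQ_inverse_real_of_nat])
    then show "\<forall>\<^sub>F n in sequentially. \<forall>t\<in>{a..b}. dist (poly (p n) t) (f t) < e"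
    proof eventually_elim
      case (elim n)
      show ?case
      proof
        fix t assume "t \<in> {a..b}"
        from p[OF this, of n] elim show "dist (poly (p n) t) (f t) < e"
          unfolding dist_real_def abs_minus_commute[of "f t"] by linarith
      qed
    qed
  qed
  then show ?thesis by (rule that)
qed

lemma powr_tangent_le:
  fixes r a b :: real
  assumes "r \<ge> 1" "a > 0" "b \<ge> 0"
  shows "a powr r + r * a powr (r - 1) * (b - a) \<le> b powr r"
proof (cases "b = 0")
  \<comment> \<open>Convexity is invoked on the open half-line, so b = 0 is separate: there the
    tangent line has the value (1 - r) a^r \<le> 0.\<close>
  case True
  have "a powr (r - 1) * a = a powr r" using assms by (simp add: powr_mult_base mult.commute)
  then have "a powr r + r * a powr (r - 1) * (b - a) = (1 - r) * a powr r"
    using True by (simp add: algebra_simps)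
  also have "\<dots> \<le> 0" using assms by (intro mult_nonpos_nonneg) auto
  finally show ?thesis using True by simp
next
  case False
  then have b: "b > 0" using assms by simp
  have "convex_on {0<..} (\<lambda>x. x powr r)"
    by (rule powr_convex[OF assms(1)])
  moreover have "((\<lambda>x. x powr r) has_real_derivative r * a powr (r - 1)) (at a)"
    by (rule has_real_derivative_powr) fact
  ultimately have "b powr r - a powr r \<ge> r * a powr (r - 1) * (b - a)"
    by (intro convex_on_imp_above_tangent[where A = "{0<..}"]) 
      (use assms b in \<open>auto simp: has_field_derivative_at_within connected_iff_interval interior_open\<close>)
  then show ?thesis by simp
qed

context A_positive_operator
begin

abbreviation converges_to_powr :: "real \<Rightarrow> (nat \<Rightarrow> real poly) \<Rightarrow> bool"
  where "converges_to_powr s p \<equiv> uniform_limit {0..M} (\<lambda>n. poly (p n)) (\<lambda>t. t powr s) sequentially"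

text \<open>Two sequences and two indices are allowed at once: p = q gives the Cauchy property, and
  different p, q give independence of the approximation.\<close>

lemma op_poly_powr_close:
  assumes p: "converges_to_powr s p" and q: "converges_to_powr s q" and e: "e > 0"
  obtains N where "\<And>m n x. m \<ge> N \<Longrightarrow> n \<ge> N \<Longrightarrow>
    A_norm A (op_poly (p m) S x - op_poly (q n) S x) \<le> e * A_norm A x"
proof -
  have "\<forall>\<^sub>F n in sequentially. (\<forall>t\<in>{0..M}. dist (poly (p n) t) (t powr s) < e / 2)
      \<and> (\<forall>t\<in>{0..M}. dist (poly (q n) t) (t powr s) < e / 2)"
    using uniform_limitD[OF p, of "e / 2"] uniform_limitD[OF q, of "e / 2"] e
    by (auto intro: eventually_conj)
  then obtain N where N: "\<And>n t. n \<ge> N \<Longrightarrow> t \<in> {0..M} \<Longrightarrow> dist (poly (p n) t) (t powr s) < e / 2"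
    "\<And>n t. n \<ge> N \<Longrightarrow> t \<in> {0..M} \<Longrightarrow> dist (poly (q n) t) (t powr s) < e / 2"
    unfolding eventually_sequentially by blast
  show ?thesis
  proof (rule that)
    fix m n x assume mn: "m \<ge> N" "n \<ge> N"
    have "A_norm A (op_poly (p m - q n) S x) \<le> e * A_norm A x"
    proof (rule A_norm_op_poly_le)
      fix t assume "0 \<le> t" "t \<le> M"
      then have "\<bar>poly (p m) t - t powr s\<bar> < e / 2" "\<bar>poly (q n) t - t powr s\<bar> < e / 2"
        using N(1)[OF mn(1), of t] N(2)[OF mn(2), of t] by (simp_all only: dist_real_def atLeastAtMost_iff)
      then show "\<bar>poly (p m - q n) t\<bar> \<le> e" unfolding poly_diff by linarith
    qed
    then show "A_norm A (op_poly (p m) S x - op_poly (q n) S x) \<le> e * A_norm A x"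
      by (simp add: op_poly_minus[OF linear_S])
  qed
qed

lemma op_poly_powr_bound:
  assumes p: "converges_to_powr s p" and s: "s > 0"
  obtains N where "\<And>n x. n \<ge> N \<Longrightarrow> A_norm A (op_poly (p n) S x) \<le> (M powr s + 1) * A_norm A x"
proof -
  obtain N where N: "\<And>n t. n \<ge> N \<Longrightarrow> t \<in> {0..M} \<Longrightarrow> dist (poly (p n) t) (t powr s) < 1"
    using uniform_limitD[OF p, of 1] unfolding eventually_sequentially by (meson zero_less_one)
  show ?thesis
  proof (rule that, rule A_norm_op_poly_le)
    fix n t assume n: "n \<ge> N" and t: "0 \<le> t" "t \<le> M"
    have "t powr s \<le> M powr s" using t s by (intro powr_mono2) auto
    moreover have "\<bar>poly (p n) t - t powr s\<bar> < 1" using N[OF n, of t] t by (simp add: dist_real_def)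
    moreover have "0 \<le> t powr s" by simp
    ultimately show "\<bar>poly (p n) t\<bar> \<le> M powr s + 1" by linarith
  qed
qed

text \<open>The operator index and the vector index run together; this diagonal sequence represents
  the power applied to the class of X.\<close>

lemma A_Cauchy_op_poly_powr:
  assumes p: "converges_to_powr s p" and s: "s > 0" and X: "X \<in> A_Cauchy A"
  shows "(\<lambda>n. op_poly (p n) S (X n)) \<in> A_Cauchy A"
  unfolding A_Cauchy_def mem_Collect_eq
proof (intro allI impI)
  fix e :: real assume e: "e > 0"
  obtain a where a: "(\<lambda>n. A_norm A (X n)) \<longlonglongrightarrow> a" by (rule A_norm_convergent[OF X])
  \<comment> \<open>B eventually bounds the vectors and K eventually bounds the polynomials as
    operators; each of the two error terms is then below e/2.\<close>
  define B where "B = \<bar>a\<bar> + 1"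
  have B: "B > 0" by (simp add: B_def)
  define K where "K = M powr s + 1"
  have K: "K > 0" by (simp add: K_def add_nonneg_pos)
  have "\<forall>\<^sub>F n in sequentially. A_norm A (X n) < B"
    by (rule order_tendstoD(2)[OF a]) (simp add: B_def)
  then obtain N0 where N0: "\<And>n. n \<ge> N0 \<Longrightarrow> A_norm A (X n) < B"
    by (auto simp: eventually_sequentially)
  have "e / (2 * B) > 0" using e B by simp
  then obtain N where N: "\<And>m n x. m \<ge> N \<Longrightarrow> n \<ge> N \<Longrightarrow>
      A_norm A (op_poly (p m) S x - op_poly (p n) S x) \<le> e / (2 * B) * A_norm A x"
    using op_poly_powr_close[OF p p] by blast
  obtain N' where N': "\<And>n x. n \<ge> N' \<Longrightarrow> A_norm A (op_poly (p n) S x) \<le> K * A_norm A x"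
    using op_poly_powr_bound[OF p s] K_def by blast
  have "e / (2 * K) > 0" using e K by simp
  then obtain N1 where N1: "\<And>m n. m \<ge> N1 \<Longrightarrow> n \<ge> N1 \<Longrightarrow> A_norm A (X m - X n) < e / (2 * K)"
    using A_CauchyE[OF X] by blast
  have "A_norm A (op_poly (p m) S (X m) - op_poly (p n) S (X n)) < e"
    if m: "m \<ge> max (max N0 N) (max N' N1)" and n: "n \<ge> max (max N0 N) (max N' N1)" for m n
  proof -
    have "A_norm A (op_poly (p m) S (X m) - op_poly (p n) S (X n))
        \<le> A_norm A (op_poly (p m) S (X m) - op_poly (p n) S (X m))
          + A_norm A (op_poly (p n) S (X m) - op_poly (p n) S (X n))"
      by (rule A_norm_triangle_diff)
    also have "\<dots> \<le> e / (2 * B) * A_norm A (X m) + K * A_norm A (X m - X n)"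
      using N[of m n "X m"] N'[of n "X m - X n"] m n by (simp add: op_poly_diff)
    also have "\<dots> < e / (2 * B) * B + K * (e / (2 * K))"
      using N0[of m] N1[of m n] m n e B K by (intro add_strict_mono mult_strict_left_mono) auto
    also have "\<dots> = e" using B K by (simp add: field_simps)
    finally show ?thesis .
  qed
  then show "\<exists>N. \<forall>m\<ge>N. \<forall>n\<ge>N. A_norm A (op_poly (p m) S (X m) - op_poly (p n) S (X n)) < e"
    by (intro exI[of _ "max (max N0 N) (max N' N1)"] allI impI)
qed

lemma exists_converges_to_powr:
  assumes "s > 0"
  obtains p where "converges_to_powr s p"
proof (rule weierstrass_real_poly)
  show "continuous_on {0..M} (\<lambda>t. t powr s)"
    using assms by (intro continuous_on_powr' continuous_on_id continuous_on_const) auto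
qed

text \<open>With n fixed, the pointwise estimate survives the limit along the diagonal index k. The
  threshold N does not depend on X, so convergence is in operator norm.\<close>

lemma compl_poly_tendsto:
  assumes p: "converges_to_powr s p" and q: "converges_to_powr s q" and s: "s > 0" and e: "e > 0"
  shows "\<forall>\<^sub>F n in sequentially. \<forall>X\<in>A_Cauchy A.
    compl_norm A (compl_diff A (compl_poly A (p n) (compl_lift A S) (A_class A X))
      (A_class A (\<lambda>k. op_poly (q k) S (X k)))) \<le> e * compl_norm A (A_class A X)"
proof -
  obtain N where N: "\<And>m n x. m \<ge> N \<Longrightarrow> n \<ge> N \<Longrightarrow>
      A_norm A (op_poly (p m) S x - op_poly (q n) S x) \<le> e * A_norm A x"
    using op_poly_powr_close[OF p q e] by blast
  show ?thesis
  proof (rule eventually_sequentiallyI[of N], rule ballI)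
    fix n X assume n: "n \<ge> N" and X: "X \<in> A_Cauchy A"
    note C = A_Cauchy_op_poly[OF X, of "p n"] A_Cauchy_op_poly_powr[OF q s X]
    have "compl_norm A (A_class A (\<lambda>k. op_poly (p n) S (X k) - op_poly (q k) S (X k)))
        \<le> e * compl_norm A (A_class A X)"
    proof (rule LIMSEQ_le)
      show "(\<lambda>k. A_norm A (op_poly (p n) S (X k) - op_poly (q k) S (X k))) \<longlonglongrightarrow>
          compl_norm A (A_class A (\<lambda>k. op_poly (p n) S (X k) - op_poly (q k) S (X k)))"
        by (rule A_norm_tendsto_compl_norm[OF A_Cauchy_diff[OF C]])
      show "(\<lambda>k. e * A_norm A (X k)) \<longlonglongrightarrow> e * compl_norm A (A_class A X)"
        by (intro tendsto_intros A_norm_tendsto_compl_norm X)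
    qed (use N n in blast)
    then show "compl_norm A (compl_diff A (compl_poly A (p n) (compl_lift A S) (A_class A X))
        (A_class A (\<lambda>k. op_poly (q k) S (X k)))) \<le> e * compl_norm A (A_class A X)"
      by (simp add: compl_poly_class[OF X] compl_diff_class[OF C])
  qed
qed

text \<open>Settles existence and uniqueness for the description in \<open>compl_powr\<close>, and
  at the same time shows that its value may be computed from any approximating sequence and any
  representative.\<close>

lemma compl_powr_class:
  assumes q: "converges_to_powr s q" and s: "s > 0" and X: "X \<in> A_Cauchy A"
  shows "compl_powr A (compl_lift A S) s (A_class A X) = A_class A (\<lambda>n. op_poly (q n) S (X n))"
proof -
  define R where "R G \<longleftrightarrow> G \<in> A_compl A \<rightarrow>\<^sub>E A_compl A \<and>
      (\<forall>p. converges_to_powr s p \<longrightarrow>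
        (\<forall>e>0. \<forall>\<^sub>F n in sequentially. \<forall>u\<in>A_compl A.
          compl_norm A (compl_diff A (compl_poly A (p n) (compl_lift A S) u) (G u))
            \<le> e * compl_norm A u))" for G
  have "\<exists>X. u \<in> A_compl A \<longrightarrow> X \<in> A_Cauchy A \<and> u = A_class A X" for u
    using A_compl_cases by metis
  then obtain rep where rep: "\<And>u. u \<in> A_compl A \<Longrightarrow> rep u \<in> A_Cauchy A"
    "\<And>u. u \<in> A_compl A \<Longrightarrow> A_class A (rep u) = u" by metis
  \<comment> \<open>A choice of representatives turns the diagonal construction into a HOL function;
    the restriction to \<open>A_compl A\<close> makes it extensional.\<close>
  define G where "G = (\<lambda>u\<in>A_compl A. A_class A (\<lambda>n. op_poly (q n) S (rep u n)))"
  have "R G"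
    unfolding R_def
  proof (intro conjI allI impI)
    show "G \<in> A_compl A \<rightarrow>\<^sub>E A_compl A"
      by (auto simp: G_def intro!: A_class_in_compl A_Cauchy_op_poly_powr[OF q s] rep)
    fix p and e :: real assume p: "converges_to_powr s p" and e: "e > 0"
    show "\<forall>\<^sub>F n in sequentially. \<forall>u\<in>A_compl A.
        compl_norm A (compl_diff A (compl_poly A (p n) (compl_lift A S) u) (G u)) \<le> e * compl_norm A u"
      using compl_poly_tendsto[OF p q s e]
    proof eventually_elim
      case (elim n)
      show ?case
      proof
        fix u assume u: "u \<in> A_compl A"
        show "compl_norm A (compl_diff A (compl_poly A (p n) (compl_lift A S) u) (G u)) \<le> e * compl_norm A u"
          using bspec[OF elim rep(1)[OF u]] u by (simp add: G_def rep(2))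
      qed
    qed
  qed
  \<comment> \<open>Both G' u and the diagonal class are close to the same p_n(S) u, hence equal.
    Applied to G as well, this removes the dependence on \<open>rep\<close>.\<close>
  moreover have "G' u = A_class A (\<lambda>n. op_poly (q n) S (X n))"
    if G': "R G'" and X: "X \<in> A_Cauchy A" and u: "u = A_class A X" for G' u X
  proof -
    have uc: "u \<in> A_compl A" using X u by (simp add: A_class_in_compl)
    then have "G' u \<in> A_compl A" using G' by (auto simp: R_def)
    then obtain Y where Y: "Y \<in> A_Cauchy A" "G' u = A_class A Y" by (rule A_compl_cases)
    let ?Z = "\<lambda>n. op_poly (q n) S (X n)"
    have Z: "?Z \<in> A_Cauchy A" by (rule A_Cauchy_op_poly_powr[OF q s X])
    have YZ: "(\<lambda>n. Y n - ?Z n) \<in> A_Cauchy A" using Y(1) Z by (rule A_Cauchy_diff)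
    let ?d = "compl_norm A (A_class A (\<lambda>n. Y n - ?Z n))"
    have "?d \<le> 0 + e" if e: "e > 0" for e
    proof -
      let ?u = "compl_norm A u"
      have u0: "?u \<ge> 0" by (rule compl_norm_nonneg[OF uc])
      \<comment> \<open>Two errors of size e' times the norm of u must total at most e; the added 1
        covers u of norm 0.\<close>
      define e' where "e' = e / (2 * (?u + 1))"
      have e': "e' > 0" using e u0 by (simp add: e'_def)
      have "\<forall>\<^sub>F n in sequentially. \<forall>u\<in>A_compl A.
          compl_norm A (compl_diff A (compl_poly A (q n) (compl_lift A S) u) (G' u)) \<le> e' * compl_norm A u"
        using G' q e' by (simp add: R_def)
      from eventually_happens'[OF _ eventually_conj[OF this compl_poly_tendsto[OF q q s e']]]
      obtain n where n: "compl_norm A (compl_diff A (compl_poly A (q n) (compl_lift A S) u) (G' u)) \<le> e' * ?u"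
        "compl_norm A (compl_diff A (compl_poly A (q n) (compl_lift A S) u) (A_class A ?Z)) \<le> e' * ?u"
        using uc X u by auto
      let ?P = "\<lambda>k. op_poly (q n) S (X k)"
      have P: "?P \<in> A_Cauchy A" by (rule A_Cauchy_op_poly[OF X])
      have n': "compl_norm A (A_class A (\<lambda>k. ?P k - Y k)) \<le> e' * ?u"
        "compl_norm A (A_class A (\<lambda>k. ?P k - ?Z k)) \<le> e' * ?u"
        using n by (simp_all add: u Y(2)[unfolded u] compl_poly_class[OF X] compl_diff_class P Y(1) Z)
      have "?d \<le> compl_norm A (A_class A (\<lambda>k. ?P k - Y k)) + compl_norm A (A_class A (\<lambda>k. ?P k - ?Z k))"
      proof (rule LIMSEQ_le)
        show "(\<lambda>k. A_norm A (Y k - ?Z k)) \<longlonglongrightarrow> ?d"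
          by (rule A_norm_tendsto_compl_norm[OF YZ])
        show "(\<lambda>k. A_norm A (?P k - Y k) + A_norm A (?P k - ?Z k)) \<longlonglongrightarrow>
            compl_norm A (A_class A (\<lambda>k. ?P k - Y k)) + compl_norm A (A_class A (\<lambda>k. ?P k - ?Z k))"
          by (intro tendsto_add A_norm_tendsto_compl_norm A_Cauchy_diff P Y Z)
        show "\<exists>N. \<forall>k\<ge>N. A_norm A (Y k - ?Z k) \<le> A_norm A (?P k - Y k) + A_norm A (?P k - ?Z k)"
          using A_norm_triangle_diff A_norm_minus_commute by metis
      qed
      also have "\<dots> \<le> 2 * (e' * ?u)" using n' by simp
      also have "\<dots> = e * (?u / (?u + 1))" using u0 by (simp add: e'_def field_simps)
      also have "\<dots> \<le> e * 1" using e u0 by (intro mult_left_mono) auto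
      finally show ?thesis by simp
    qed
    then have "?d \<le> 0" by (rule field_le_epsilon)
    then have "?d = 0" using compl_norm_nonneg[OF A_class_in_compl[OF YZ]] by simp
    then have "(\<lambda>n. A_norm A (Y n - ?Z n)) \<longlonglongrightarrow> 0"
      using A_norm_tendsto_compl_norm[OF YZ] by simp
    then show ?thesis unfolding Y(2) by (rule A_class_eqI[OF Y(1) Z])
  qed
  note eq = this
  have "(THE G. R G) = G"
  proof (rule the_equality[where P = R], fact)
    fix G' assume G': "R G'"
    show "G' = G"
    proof (rule extensionalityI[of _ "A_compl A"])
      show "G' \<in> extensional (A_compl A)" "G \<in> extensional (A_compl A)"
        using G' \<open>R G\<close> by (auto simp: R_def PiE_def)
      fix u assume "u \<in> A_compl A"
      then obtain X where "X \<in> A_Cauchy A" "u = A_class A X" by (rule A_compl_cases)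
      then show "G' u = G u" using eq[OF G'] eq[OF \<open>R G\<close>] by simp
    qed
  qed
  then have "compl_powr A (compl_lift A S) s = G"
    unfolding compl_powr_def M_def[symmetric] R_def by simp
  then show ?thesis using eq[OF \<open>R G\<close> X refl] by simp
qed

lemma compl_norm_compl_powr_le:
  assumes q: "converges_to_powr s q" and s: "s > 0" and X: "X \<in> A_Cauchy A"
  shows "compl_norm A (A_class A (\<lambda>n. op_poly (q n) S (X n))) \<le> (M powr s + 1) * compl_norm A (A_class A X)"
proof (rule LIMSEQ_le)
  show "(\<lambda>n. A_norm A (op_poly (q n) S (X n))) \<longlonglongrightarrow> compl_norm A (A_class A (\<lambda>n. op_poly (q n) S (X n)))"
    by (rule A_norm_tendsto_compl_norm[OF A_Cauchy_op_poly_powr[OF q s X]])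
  show "(\<lambda>n. (M powr s + 1) * A_norm A (X n)) \<longlonglongrightarrow> (M powr s + 1) * compl_norm A (A_class A X)"
    by (intro tendsto_intros A_norm_tendsto_compl_norm X)
  show "\<exists>N. \<forall>n\<ge>N. A_norm A (op_poly (q n) S (X n)) \<le> (M powr s + 1) * A_norm A (X n)"
    using op_poly_powr_bound[OF q s] by metis
qed

(* McCarthy's inequality: t^(2r) lies above the tangent line at |Sx|^2 of a \<mapsto> a^r, taken at a = t^2. *)
lemma mccarthy:
  assumes q: "converges_to_powr (2 * r) q" and r: "r \<ge> 1" and x: "A_norm A x = 1" and e: "e > 0"
  shows "\<forall>\<^sub>F n in sequentially. A_norm A (S x) powr (2 * r) - e \<le> semi_inner (op_poly (q n) S x) x"
proof -
  define a where "a = (A_norm A (S x))\<^sup>2"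
  define c where "c = r * a powr (r - 1)"
  have tangent: "a powr r + c * (t\<^sup>2 - a) \<le> t powr (2 * r)" if "t \<ge> 0" for t
  proof -
    have "(t\<^sup>2) powr r = t powr (2 * r)"
      using that by (cases "t = 0") (simp_all add: powr_powr flip: powr_numeral)
    moreover have "a powr r + c * (t\<^sup>2 - a) \<le> (t\<^sup>2) powr r"
    \<comment> \<open>If a = 0, both powers of a are 0 by the convention
      \<open>0 powr x = 0\<close>, so the left side is 0 even for r = 1.\<close>
    proof (cases "a = 0")
      case False
      then have "a > 0" by (simp add: a_def)
      then show ?thesis unfolding c_def by (intro powr_tangent_le r) auto
    qed (simp add: c_def)
    ultimately show ?thesis by simp
  qed
  have "a powr r = A_norm A (S x) powr (2 * r)"
    using A_norm_nonneg[of "S x"]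
    by (cases "A_norm A (S x) = 0") (simp_all add: a_def powr_powr flip: powr_numeral)
  \<comment> \<open>The comparison polynomial is the tangent line in t^2, lowered by e. Since <S^2
    x, x> = a and x is a unit vector, its linear part cancels at x and a^r - e remains.\<close>
  moreover have "semi_inner (op_poly ([:a powr r - c * a - e:] + smult c ([:0, 1:]\<^sup>2)) S x) x = a powr r - e"
  proof -
    have "semi_inner (op_poly ([:0, 1:]\<^sup>2) S x) x = a"
      unfolding A_norm_op_poly_square[symmetric] by (simp only: op_poly_monom1[OF linear_S] a_def)
    moreover have "semi_inner x x = 1" using x by (simp flip: A_norm_square)
    ultimately show ?thesis
      by (simp only: op_poly_add[OF linear_S] op_poly_smult[OF linear_S] op_poly_const[OF linear_S] semi_inner_simps)
        (simp add: algebra_simps)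
  qed
  moreover have "\<forall>\<^sub>F n in sequentially. \<forall>t\<in>{0..M}. dist (poly (q n) t) (t powr (2 * r)) < e"
    by (rule uniform_limitD[OF q e])
  then have "\<forall>\<^sub>F n in sequentially.
      0 \<le> semi_inner (op_poly (q n - ([:a powr r - c * a - e:] + smult c ([:0, 1:]\<^sup>2))) S x) x"
  proof eventually_elim
    case (elim n)
    show ?case
    proof (rule op_poly_nonneg)
      fix t assume t: "0 \<le> t" "t \<le> M"
      then have "\<bar>poly (q n) t - t powr (2 * r)\<bar> < e" using elim by (simp add: dist_real_def)
      then show "0 \<le> poly (q n - ([:a powr r - c * a - e:] + smult c ([:0, 1:]\<^sup>2))) t"
        using tangent[OF t(1)] by (simp add: algebra_simps)
    qed
  qed
  ultimately show ?thesis
    by (simp only: op_poly_minus[OF linear_S] semi_inner_simps) simp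
qed

end

text \<open>The sum of powers is tested on the constant sequence of x. Its norm dominates its inner
  product with x, where McCarthy's inequality applies to each summand; S and R have their own
  intervals and hence their own approximants.\<close>

lemma A_norm_powr_add_bound:
  assumes S: "A_positive_operator A S" and R: "A_positive_operator A R" and r: "r \<ge> 1"
  shows A_norm_powr_add_ge: "A_norm A x = 1 \<Longrightarrow>
      A_norm A (S x) powr (2 * r) + A_norm A (R x) powr (2 * r) \<le> A_norm_powr_add A S R (2 * r)"
    and A_norm_powr_add_nonneg: "0 \<le> A_norm_powr_add A S R (2 * r)"
proof -
  interpret S: A_positive_operator A S by fact
  interpret R: A_positive_operator A R by fact
  let ?s = "2 * r"
  have s: "?s > 0" using r by simp
  obtain p where p: "S.converges_to_powr ?s p" using S.exists_converges_to_powr[OF s] .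
  obtain q where q: "R.converges_to_powr ?s q" using R.exists_converges_to_powr[OF s] .
  define F where "F u = compl_add A (compl_powr A (compl_lift A S) ?s u)
      (compl_powr A (compl_lift A R) ?s u)" for u
  have C: "(\<lambda>n. op_poly (p n) S (X n)) \<in> A_Cauchy A" "(\<lambda>n. op_poly (q n) R (X n)) \<in> A_Cauchy A"
    if "X \<in> A_Cauchy A" for X
    using that by (auto intro: S.A_Cauchy_op_poly_powr[OF p s] R.A_Cauchy_op_poly_powr[OF q s])
  have F: "F (A_class A X) = A_class A (\<lambda>n. op_poly (p n) S (X n) + op_poly (q n) R (X n))"
    if "X \<in> A_Cauchy A" for X
    unfolding F_def S.compl_powr_class[OF p s that] R.compl_powr_class[OF q s that]
    by (intro S.compl_add_class C that)
  define K where "K = (S.M powr ?s + 1) + (R.M powr ?s + 1)"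
  have le: "compl_norm A (F u) \<le> K * compl_norm A u" if u: "u \<in> A_compl A" for u
  proof -
    obtain X where X: "X \<in> A_Cauchy A" "u = A_class A X" using S.A_compl_cases[OF u] .
    let ?P = "\<lambda>n. op_poly (p n) S (X n)" and ?Q = "\<lambda>n. op_poly (q n) R (X n)"
    have "compl_norm A (F u) \<le> compl_norm A (A_class A ?P) + compl_norm A (A_class A ?Q)"
      unfolding X(2) F[OF X(1)]
    proof (rule LIMSEQ_le)
      show "(\<lambda>n. A_norm A (?P n + ?Q n)) \<longlonglongrightarrow> compl_norm A (A_class A (\<lambda>n. ?P n + ?Q n))"
        by (intro S.A_norm_tendsto_compl_norm S.A_Cauchy_add C X)
      show "(\<lambda>n. A_norm A (?P n) + A_norm A (?Q n)) \<longlonglongrightarrow>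
          compl_norm A (A_class A ?P) + compl_norm A (A_class A ?Q)"
        by (intro tendsto_add S.A_norm_tendsto_compl_norm C X)
    qed (use S.A_norm_triangle in blast)
    also have "\<dots> \<le> K * compl_norm A u"
      using S.compl_norm_compl_powr_le[OF p s X(1)] R.compl_norm_compl_powr_le[OF q s X(1)]
      by (simp add: K_def X(2) algebra_simps)
    finally show ?thesis .
  qed
  have K: "K \<ge> 0" by (simp add: K_def add_nonneg_nonneg)
  have up: "compl_norm A (F (A_class A (\<lambda>_. x))) \<le> A_norm_powr_add A S R ?s" if "A_norm A x \<le> 1" for x
    unfolding A_norm_powr_add_def F_def[symmetric]
    by (rule S.compl_opnorm_upper[OF le K])
      (use that in \<open>auto simp: S.compl_norm_const intro: S.A_class_in_compl S.A_Cauchy_const\<close>)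
  have Fx: "(\<lambda>n. A_norm A (op_poly (p n) S x + op_poly (q n) R x)) \<longlonglongrightarrow> compl_norm A (F (A_class A (\<lambda>_. x)))" for x
    unfolding F[OF S.A_Cauchy_const]
    by (intro S.A_norm_tendsto_compl_norm S.A_Cauchy_add C S.A_Cauchy_const)
  \<comment> \<open>The zero vector is admissible in the supremum, which is therefore at least a
    nonnegative limit of seminorms.\<close>
  show "0 \<le> A_norm_powr_add A S R ?s"
    using up[of 0] LIMSEQ_le_const[OF Fx[of 0], of 0] S.A_norm_nonneg
    by (simp add: S.A_norm_zero)
  assume x: "A_norm A x = 1"
  have "A_norm A (S x) powr ?s + A_norm A (R x) powr ?s \<le> compl_norm A (F (A_class A (\<lambda>_. x))) + e"
    if e: "e > 0" for e
  proof -
    have e2: "e / 2 > 0" using e by simp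
    have "\<forall>\<^sub>F n in sequentially. A_norm A (S x) powr ?s + A_norm A (R x) powr ?s - e
        \<le> A_norm A (op_poly (p n) S x + op_poly (q n) R x)"
      using S.mccarthy[OF p r x e2] R.mccarthy[OF q r x e2]
    proof eventually_elim
      case (elim n)
      then have "A_norm A (S x) powr ?s + A_norm A (R x) powr ?s - e
          \<le> S.semi_inner (op_poly (p n) S x + op_poly (q n) R x) x"
        by (simp add: S.semi_inner_simps)
      also have "\<dots> \<le> A_norm A (op_poly (p n) S x + op_poly (q n) R x) * A_norm A x"
        by (rule S.semi_inner_le)
      finally show ?case by (simp add: x)
    qed
    from tendsto_lowerbound[OF Fx this] show ?thesis by simp
  qed
  then have "A_norm A (S x) powr ?s + A_norm A (R x) powr ?s \<le> compl_norm A (F (A_class A (\<lambda>_. x)))"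
    by (rule field_le_epsilon)
  also have "\<dots> \<le> A_norm_powr_add A S R ?s" using up x by simp
  finally show "A_norm A (S x) powr ?s + A_norm A (R x) powr ?s \<le> A_norm_powr_add A S R ?s" .
qed

section \<open>The numerical radius inequality\<close>

text \<open>All three properties come from <T# T x, y> = <T x, T y> in the semi-inner
  product.\<close>

lemma A_positive_operator_sharp:
  fixes A :: "'a::chilbert_space \<Rightarrow> 'a"
  assumes A: "positive_op A" and T: "T \<in> B_A A"
  shows "A_positive_operator A (A_sharp A T \<circ> T)"
proof -
  interpret positive_operator A by standard fact
  have s: "semi_inner (A_sharp A T x) y = semi_inner x (T y)" for x y
    by (simp add: semi_inner_def A_sharp(2)[OF A T])
  have "bounded_clinear (A_sharp A T \<circ> T)"
    using A_sharp(1)[OF A T] T by (auto simp: B_A_def intro: bounded_clinear_compose)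
  then have "bounded_linear (A_sharp A T \<circ> T)" by (simp add: bounded_clinear_def)
  moreover have "semi_inner ((A_sharp A T \<circ> T) x) y = semi_inner x ((A_sharp A T \<circ> T) y)" for x y
    using s[of "T x" y] s[of "T y" x] by (simp add: semi_inner_commute)
  moreover have "semi_inner ((A_sharp A T \<circ> T) x) x \<ge> 0" for x
    by (simp add: s semi_inner_nonneg)
  ultimately show ?thesis
    by (intro A_positive_operator.intro A_positive_operator_axioms.intro positive_operator_axioms)
qed

text \<open>The tangent at the mean a is evaluated at u and v and averaged; the linear terms cancel.
  The tangent bound admits u or v equal to 0.\<close>

lemma powr_convex_combination:
  fixes \<alpha> r u v :: real
  assumes r: "r \<ge> 1" and "0 \<le> \<alpha>" "\<alpha> \<le> 1" "u \<ge> 0" "v \<ge> 0"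
  shows "(\<alpha> * u + (1 - \<alpha>) * v) powr r \<le> \<alpha> * u powr r + (1 - \<alpha>) * v powr r"
proof -
  define a where "a = \<alpha> * u + (1 - \<alpha>) * v"
  have "a \<ge> 0" using assms by (simp add: a_def)
  show ?thesis
  proof (cases "a = 0")
    case True
    then show ?thesis using assms by (simp add: a_def[symmetric])
  next
    case False
    then have a: "a > 0" using \<open>a \<ge> 0\<close> by simp
    have "a powr r = \<alpha> * (a powr r + r * a powr (r - 1) * (u - a))
        + (1 - \<alpha>) * (a powr r + r * a powr (r - 1) * (v - a))
        - r * a powr (r - 1) * (\<alpha> * u + (1 - \<alpha>) * v - a)"
      by (simp add: algebra_simps)
    also have "\<dots> \<le> \<alpha> * u powr r + (1 - \<alpha>) * v powr r"
      using assms powr_tangent_le[OF r a, of u] powr_tangent_le[OF r a, of v]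
      by (simp add: a_def[symmetric] add_mono mult_left_mono)
    finally show ?thesis by (simp add: a_def)
  qed
qed

lemma quartic_powr_bound:
  fixes k m c \<phi> \<rho> r \<beta> :: real
  assumes "\<beta> \<ge> 0" and r: "r \<ge> 1" and k: "k \<ge> 0" "k\<^sup>2 \<le> (m + c) / 2"
    and c: "0 \<le> c" "c \<le> m" and \<phi>: "m powr r \<le> \<phi> / 2" and \<rho>: "c powr r \<le> \<rho>"
  shows "k powr (4 * r) \<le> (1 + 2 * \<beta>) / (16 * (\<beta> + 1)) * \<phi>\<^sup>2 + (3 + 2 * \<beta>) / (8 * (\<beta> + 1)) * \<phi> * \<rho>"
proof -
  define \<alpha> where "\<alpha> = (1 + 2 * \<beta>) / (4 * (\<beta> + 1))"
  have \<alpha>: "1 / 4 \<le> \<alpha>" "\<alpha> \<le> 1" "1 - \<alpha> = (3 + 2 * \<beta>) / (4 * (\<beta> + 1))"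
    using \<open>\<beta> \<ge> 0\<close> by (simp_all add: \<alpha>_def field_simps)
  have m: "m \<ge> 0" using c by simp
  have "k ^ 4 = (k\<^sup>2)\<^sup>2" by simp
  also have "\<dots> \<le> ((m + c) / 2)\<^sup>2" using k by (intro power_mono) auto
  also have "\<dots> = (m * m + 2 * (m * c) + c * c) / 4"
    by (simp add: power2_eq_square field_simps)
  also have "\<dots> \<le> (m * m + 3 * (m * c)) / 4" using mult_right_mono[OF c(2,1)] by (simp add: mult.commute)
  \<comment> \<open>Moving the weight \<alpha> - 1/4 from mc to m^2 leaves a correction of
    favourable sign, because m \<ge> c.\<close>
  also have "\<dots> = \<alpha> * (m * m) + (1 - \<alpha>) * (m * c) - (\<alpha> - 1 / 4) * (m * (m - c))"
    by (simp add: algebra_simps)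
  also have "\<dots> \<le> \<alpha> * (m * m) + (1 - \<alpha>) * (m * c)" using \<alpha> c m by simp
  finally have k4: "k ^ 4 \<le> \<alpha> * (m * m) + (1 - \<alpha>) * (m * c)" .
  have "k powr (4 * r) = (k ^ 4) powr r"
    using k(1) by (cases "k = 0") (simp_all add: powr_powr flip: powr_numeral)
  also have "\<dots> \<le> (\<alpha> * (m * m) + (1 - \<alpha>) * (m * c)) powr r"
    using k4 r k(1) by (intro powr_mono2) auto
  also have "\<dots> \<le> \<alpha> * (m * m) powr r + (1 - \<alpha>) * (m * c) powr r"
    using r \<alpha> m c by (intro powr_convex_combination) auto
  also have "\<dots> = \<alpha> * (m powr r * m powr r) + (1 - \<alpha>) * (m powr r * c powr r)"
    using m c by (simp add: powr_mult)
  also have "\<dots> \<le> \<alpha> * (\<phi> / 2 * (\<phi> / 2)) + (1 - \<alpha>) * (\<phi> / 2 * \<rho>)"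
  proof -
    have "0 \<le> \<phi> / 2" using \<phi> powr_ge_zero[of m r] by linarith
    then show ?thesis using \<phi> \<rho> \<alpha> by (intro add_mono mult_left_mono mult_mono) auto
  qed
  also have "\<dots> = \<alpha> / 4 * \<phi>\<^sup>2 + (1 - \<alpha>) / 2 * \<phi> * \<rho>"
    by (simp add: power2_eq_square)
  also have "\<alpha> / 4 = (1 + 2 * \<beta>) / (16 * (\<beta> + 1))" by (simp add: \<alpha>_def)
  also have "(1 - \<alpha>) / 2 = (3 + 2 * \<beta>) / (8 * (\<beta> + 1))" by (simp add: \<alpha>(3))
  finally show ?thesis .
qed

lemma cmod_A_inner_powr_le:
  fixes A T S :: "'a::chilbert_space \<Rightarrow> 'a" and \<beta> r :: real
  assumes A: "positive_op A" and T: "T \<in> B_A A" and S: "S \<in> B_A A"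
    and "\<beta> \<ge> 0" and r: "r \<ge> 1" and x: "A_norm A x = 1"
  defines "\<phi> \<equiv> A_norm_powr_add A (A_sharp A T \<circ> T) (A_sharp A S \<circ> S) (2 * r)"
    and "\<rho> \<equiv> A_numrad A (A_sharp A S \<circ> S \<circ> A_sharp A T \<circ> T) powr r"
  shows "cmod (A_inner A (T x) (S x)) powr (4 * r)
    \<le> (1 + 2 * \<beta>) / (16 * (\<beta> + 1)) * \<phi>\<^sup>2 + (3 + 2 * \<beta>) / (8 * (\<beta> + 1)) * \<phi> * \<rho>"
proof -
  define P where "P = A_sharp A T \<circ> T"
  define Q where "Q = A_sharp A S \<circ> S"
  have pos: "A_positive_operator A P" "A_positive_operator A Q"
    unfolding P_def Q_def by (intro A_positive_operator_sharp A T S)+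
  interpret P: A_positive_operator A P by (rule pos)
  interpret Q: A_positive_operator A Q by (rule pos)
  have Px: "P.semi_inner (P x) x = (A_norm A (T x))\<^sup>2" and Qx: "P.semi_inner (Q x) x = (A_norm A (S x))\<^sup>2"
    by (simp_all add: P_def Q_def P.A_norm_square P.semi_inner_def A_sharp(2)[OF A T] A_sharp(2)[OF A S])
  define m where "m = A_norm A (P x) * A_norm A (Q x)"
  \<comment> \<open>The modulus of the real part suffices: Buzano is used in its real form, as <Px,
    x> and <Qx, x> are real.\<close>
  define c where "c = \<bar>P.semi_inner (P x) (Q x)\<bar>"
  show ?thesis
  proof (rule quartic_powr_bound[where m = m and c = c])
    have "(cmod (A_inner A (T x) (S x)))\<^sup>2 \<le> (A_norm A (T x) * A_norm A (S x))\<^sup>2"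
      by (intro power_mono P.cmod_A_inner_le) simp
    also have "\<dots> = P.semi_inner (P x) x * P.semi_inner x (Q x)"
      by (simp add: Px Qx power_mult_distrib P.semi_inner_commute[of x])
    also have "\<dots> \<le> (m + P.semi_inner (P x) (Q x)) / 2"
      unfolding m_def by (rule P.buzano[OF x])
    also have "\<dots> \<le> (m + c) / 2" by (simp add: c_def)
    finally show "(cmod (A_inner A (T x) (S x)))\<^sup>2 \<le> (m + c) / 2" .
    show "c \<le> m"
      unfolding c_def m_def P.semi_inner_def using abs_Re_le_cmod P.cmod_A_inner_le order_trans by blast
    have "m powr r = A_norm A (P x) powr r * A_norm A (Q x) powr r"
      by (simp add: m_def powr_mult P.A_norm_nonneg)
    \<comment> \<open>The arithmetic-geometric mean step doubles the exponent to 2r and produces the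
      factor 1/2 in front of \<phi>.\<close>
    also have "\<dots> \<le> ((A_norm A (P x) powr r)\<^sup>2 + (A_norm A (Q x) powr r)\<^sup>2) / 2"
      using sum_squares_bound[of "A_norm A (P x) powr r" "A_norm A (Q x) powr r"] by simp
    also have "\<dots> = (A_norm A (P x) powr (2 * r) + A_norm A (Q x) powr (2 * r)) / 2"
      by (simp add: power2_eq_square flip: powr_add)
    also have "\<dots> \<le> \<phi> / 2"
      using A_norm_powr_add_ge[OF pos r x] by (simp add: \<phi>_def P_def Q_def)
    finally show "m powr r \<le> \<phi> / 2" .
    \<comment> \<open>Selfadjointness of Q collects both operators on one side, in the order in
      which they occur in \<rho>.\<close>
    have "c = \<bar>Re (A_inner A (Q (P x)) x)\<bar>"
      using Q.selfadjoint[of "P x" x] by (simp add: c_def P.semi_inner_def)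
    also have "\<dots> \<le> cmod (A_inner A (Q (P x)) x)" by (rule abs_Re_le_cmod)
    also have "\<dots> \<le> A_numrad A (Q \<circ> P)"
      unfolding A_numrad_def
    proof (rule cSup_upper)
      obtain C where C: "C \<ge> 0" "\<And>y. A_norm A (P y) \<le> C * A_norm A y" using P.S_bounded by blast
      obtain D where D: "D \<ge> 0" "\<And>y. A_norm A (Q y) \<le> D * A_norm A y" using Q.S_bounded by blast
      have "cmod (A_inner A (Q (P y)) y) \<le> D * C" if "A_norm A y = 1" for y
      proof -
        have "cmod (A_inner A (Q (P y)) y) \<le> A_norm A (Q (P y))"
          using P.cmod_A_inner_le[of "Q (P y)" y] that by simp
        also have "\<dots> \<le> D * A_norm A (P y)" by (rule D)
        also have "\<dots> \<le> D * C" using C(2)[of y] that D(1) by (intro mult_left_mono) auto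
        finally show ?thesis .
      qed
      then show "bdd_above (insert 0 {cmod (A_inner A ((Q \<circ> P) y) y) |y. A_norm A y = 1})"
        by (auto intro!: bdd_aboveI[of _ "D * C"] simp: C(1) D(1))
    qed (use x in auto)
    finally have "c \<le> A_numrad A (Q \<circ> P)" .
    then show "c powr r \<le> \<rho>"
      using r by (auto simp: \<rho>_def P_def Q_def comp_assoc c_def intro!: powr_mono2)
  qed (use assms in \<open>auto simp: c_def\<close>)
qed

text \<open>Homogeneity, needed because the components of a unit vector of the direct sum have
  arbitrary seminorm. Null vectors cannot be rescaled; the A-adjoint shows that T sends them to null
  vectors.\<close>

lemma cmod_A_inner_le_square:
  fixes A T S :: "'a::chilbert_space \<Rightarrow> 'a"
  assumes A: "positive_op A" and T: "T \<in> B_A A" and S: "S \<in> B_A A"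
    and unit: "\<And>x. A_norm A x = 1 \<Longrightarrow> cmod (A_inner A (T x) (S x)) \<le> w"
  shows "cmod (A_inner A (T x) (S x)) \<le> w * (A_norm A x)\<^sup>2"
proof -
  interpret positive_operator A by standard fact
  have TS: "T (c *\<^sub>C x) = c *\<^sub>C T x" "S (c *\<^sub>C x) = c *\<^sub>C S x" for c x
    using T S by (auto simp: B_A_def bounded_clinear_def)
  show ?thesis
  proof (cases "A_norm A x = 0")
    case True
    have "(A_norm A (T x))\<^sup>2 = semi_inner (A_sharp A T (T x)) x"
      by (simp add: A_norm_square semi_inner_def A_sharp(2)[OF A T])
    also have "\<dots> \<le> 0" using semi_inner_le[of "A_sharp A T (T x)" x] True by simp
    finally have "A_norm A (T x) = 0" by simp
    then show ?thesis using cmod_A_inner_le[of "T x" "S x"] True by simp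
  next
    case False
    define a where "a = A_norm A x"
    have a: "a > 0" using False A_norm_nonneg[of x] by (simp add: a_def)
    define y where "y = inverse a *\<^sub>R x"
    have xy: "x = of_real a *\<^sub>C y" using a by (simp add: y_def scaleC_of_real)
    have "A_inner A (T x) (S x) = of_real (a * a) * A_inner A (T y) (S y)"
      by (simp add: xy TS A_inner_def scaleC cinner_scaleC_left cinner_scaleC_right)
    moreover have "A_norm A y = 1" using a by (simp add: y_def A_norm_scaleR a_def[symmetric])
    ultimately show ?thesis
      using unit[of y] a by (simp add: norm_mult a_def[symmetric] power2_eq_square mult.commute)
  qed
qed

section \<open>Block operators on the direct sum and the final estimate\<close>

lemma scaleC_zero_right: "c *\<^sub>C (0 :: 'a::complex_inner) = 0"
  using scaleC_diff_right[of c "0 :: 'a" 0] by (simp only: diff_self)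

lemma bounded_clinear_zero: "bounded_clinear (\<lambda>x. 0)"
  by (simp add: bounded_clinear_def bounded_linear_zero scaleC_zero_right)

lemma bounded_clinear_block_op:
  assumes "bounded_clinear X11" "bounded_clinear X12" "bounded_clinear X21" "bounded_clinear X22"
  shows "bounded_clinear (block_op X11 X12 X21 X22)"
  unfolding bounded_clinear_def
proof (intro conjI allI)
  have "bounded_linear X11" "bounded_linear X12" "bounded_linear X21" "bounded_linear X22"
    using assms by (simp_all add: bounded_clinear_def)
  note * = this[THEN bounded_linear_compose, OF bounded_linear_fst]
    this[THEN bounded_linear_compose, OF bounded_linear_snd]
  have "bounded_linear (\<lambda>z. (X11 (fst z) + X12 (snd z), X21 (fst z) + X22 (snd z)))"
    by (intro bounded_linear_Pair bounded_linear_add *)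
  then show "bounded_linear (block_op X11 X12 X21 X22)"
    by (simp add: block_op_def[abs_def])
  show "block_op X11 X12 X21 X22 (c *\<^sub>C z) = c *\<^sub>C block_op X11 X12 X21 X22 z" for c z
    using assms by (simp add: block_op_def bounded_clinear_def scaleC_prod_def scaleC_add_right)
qed

lemma A_inner_diagonal:
  "A_inner (block_op A (\<lambda>x. 0) (\<lambda>x. 0) A) z w = A_inner A (fst z) (fst w) + A_inner A (snd z) (snd w)"
  by (simp add: A_inner_def block_op_def cinner_prod_def)

lemma positive_op_diagonal:
  assumes "positive_op A"
  shows "positive_op (block_op A (\<lambda>x. 0) (\<lambda>x. 0) A)"
  using assms unfolding positive_op_def
  by (auto intro!: bounded_clinear_block_op bounded_clinear_zero nonneg_Reals_add_I
      simp: block_op_def cinner_prod_def)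

text \<open>Taking adjoints exchanges the two corners, so the witness has R2 above R1.\<close>

lemma antidiagonal_in_B_A:
  fixes A S1 S2 :: "'a::chilbert_space \<Rightarrow> 'a"
  assumes "S1 \<in> B_A A" "S2 \<in> B_A A"
  shows "block_op (\<lambda>x. 0) S1 S2 (\<lambda>x. 0) \<in> B_A (block_op A (\<lambda>x. 0) (\<lambda>x. 0) A)"
proof -
  obtain R1 R2 where R: "bounded_clinear R1" "bounded_clinear R2"
    "\<And>x y. A_inner A (R1 x) y = A_inner A x (S1 y)" "\<And>x y. A_inner A (R2 x) y = A_inner A x (S2 y)"
    using assms by (auto simp: B_A_iff)
  have "A_inner (block_op A (\<lambda>x. 0) (\<lambda>x. 0) A) (block_op (\<lambda>x. 0) R2 R1 (\<lambda>x. 0) z) w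
      = A_inner (block_op A (\<lambda>x. 0) (\<lambda>x. 0) A) z (block_op (\<lambda>x. 0) S1 S2 (\<lambda>x. 0) w)" for z w
    by (simp add: A_inner_diagonal R(3,4)) (simp add: block_op_def R(3,4))
  then show ?thesis
    using R(1,2) assms unfolding B_A_iff
    by (intro conjI exI[of _ "block_op (\<lambda>x. 0) R2 R1 (\<lambda>x. 0)"])
      (auto intro!: bounded_clinear_block_op bounded_clinear_zero)
qed

theorem theorem2p31:
  fixes A T1 T2 S1 S2 :: "'a::chilbert_space \<Rightarrow> 'a" and \<beta> r :: real
  assumes "positive_op A"
    and "T1 \<in> B_A A" and "T2 \<in> B_A A" and "S1 \<in> B_A A" and "S2 \<in> B_A A"
    and "\<beta> \<ge> 0" and "r \<ge> 1"
  shows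
    "let AA = block_op A (\<lambda>x. 0) (\<lambda>x. 0) A;
         TT = block_op (\<lambda>x. 0) T1 T2 (\<lambda>x. 0);
         SS = block_op (\<lambda>x. 0) S1 S2 (\<lambda>x. 0);
         \<phi> = A_norm_powr_add A (A_sharp A T2 \<circ> T2) (A_sharp A S2 \<circ> S2) (2 * r);
         \<psi> = A_norm_powr_add A (A_sharp A T1 \<circ> T1) (A_sharp A S1 \<circ> S1) (2 * r);
         \<rho> = A_numrad A (A_sharp A S2 \<circ> S2 \<circ> A_sharp A T2 \<circ> T2) powr r;
         \<theta> = A_numrad A (A_sharp A S1 \<circ> S1 \<circ> A_sharp A T1 \<circ> T1) powr r
     in A_numrad AA (A_sharp AA SS \<circ> TT) powr (4 * r)
        \<le> (1 + 2 * \<beta>) / (16 * (\<beta> + 1)) * max (\<phi>\<^sup>2) (\<psi>\<^sup>2)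
          + (3 + 2 * \<beta>) / (8 * (\<beta> + 1)) * max \<phi> \<psi> * max \<rho> \<theta>"
proof -
  define AA where "AA = block_op A (\<lambda>x. 0) (\<lambda>x. 0) A"
  define TT where "TT = block_op (\<lambda>x. 0) T1 T2 (\<lambda>x. 0)"
  define SS where "SS = block_op (\<lambda>x. 0) S1 S2 (\<lambda>x. 0)"
  define \<phi> where "\<phi> = A_norm_powr_add A (A_sharp A T2 \<circ> T2) (A_sharp A S2 \<circ> S2) (2 * r)"
  define \<psi> where "\<psi> = A_norm_powr_add A (A_sharp A T1 \<circ> T1) (A_sharp A S1 \<circ> S1) (2 * r)"
  define \<rho> where "\<rho> = A_numrad A (A_sharp A S2 \<circ> S2 \<circ> A_sharp A T2 \<circ> T2) powr r"
  define \<theta> where "\<theta> = A_numrad A (A_sharp A S1 \<circ> S1 \<circ> A_sharp A T1 \<circ> T1) powr r"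
  define W where "W = (1 + 2 * \<beta>) / (16 * (\<beta> + 1)) * max (\<phi>\<^sup>2) (\<psi>\<^sup>2)
      + (3 + 2 * \<beta>) / (8 * (\<beta> + 1)) * max \<phi> \<psi> * max \<rho> \<theta>"
  \<comment> \<open>The 4r-th root of the target: a bound on the quadratic form itself, which scales
    and adds, unlike its 4r-th power.\<close>
  define w where "w = W powr (1 / (4 * r))"
  have nonneg: "0 \<le> \<phi>" "0 \<le> \<psi>" "0 \<le> \<rho>" "0 \<le> \<theta>"
    unfolding \<phi>_def \<psi>_def \<rho>_def \<theta>_def
    by (auto intro!: A_norm_powr_add_nonneg A_positive_operator_sharp assms)
  have b: "0 \<le> (1 + 2 * \<beta>) / (16 * (\<beta> + 1))" "0 \<le> (3 + 2 * \<beta>) / (8 * (\<beta> + 1))"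
    using \<open>\<beta> \<ge> 0\<close> by auto
  \<comment> \<open>To be used with (f, g) equal to (\<phi>, \<rho>) or (\<psi>, \<theta>), so that
    one bound W covers both corners.\<close>
  have le_W: "(1 + 2 * \<beta>) / (16 * (\<beta> + 1)) * f\<^sup>2 + (3 + 2 * \<beta>) / (8 * (\<beta> + 1)) * f * g \<le> W"
    if "f\<^sup>2 \<le> max (\<phi>\<^sup>2) (\<psi>\<^sup>2)" "f \<le> max \<phi> \<psi>" "g \<le> max \<rho> \<theta>" "0 \<le> f" "0 \<le> g" for f g
    unfolding W_def mult.assoc[of _ _ g] mult.assoc[of _ _ "max \<rho> \<theta>"]
    by (intro add_mono mult_left_mono mult_mono that b) (simp add: le_max_iff_disj nonneg)
  have W: "0 \<le> W"
    unfolding W_def using b nonneg by (intro add_nonneg_nonneg mult_nonneg_nonneg) (auto simp: le_max_iff_disj)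
  have root: "k \<le> w" if "k \<ge> 0" "k powr (4 * r) \<le> W" for k
  proof -
    have "k = (k powr (4 * r)) powr (1 / (4 * r))" using that(1) \<open>r \<ge> 1\<close> by (simp add: powr_powr)
    also have "\<dots> \<le> w" unfolding w_def using that \<open>r \<ge> 1\<close> by (intro powr_mono2) auto
    finally show ?thesis .
  qed
  have 1: "cmod (A_inner A (T1 x) (S1 x)) \<le> w * (A_norm A x)\<^sup>2" for x
  proof (rule cmod_A_inner_le_square[OF assms(1,2,4)], rule root)
    fix x assume "A_norm A x = 1"
    from cmod_A_inner_powr_le[OF assms(1,2,4,6,7) this, folded \<psi>_def \<theta>_def]
    show "cmod (A_inner A (T1 x) (S1 x)) powr (4 * r) \<le> W"
      by (rule order_trans) (rule le_W; simp add: nonneg)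
  qed simp
  have 2: "cmod (A_inner A (T2 x) (S2 x)) \<le> w * (A_norm A x)\<^sup>2" for x
  proof (rule cmod_A_inner_le_square[OF assms(1,3,5)], rule root)
    fix x assume "A_norm A x = 1"
    from cmod_A_inner_powr_le[OF assms(1,3,5,6,7) this, folded \<phi>_def \<rho>_def]
    show "cmod (A_inner A (T2 x) (S2 x)) powr (4 * r) \<le> W"
      by (rule order_trans) (rule le_W; simp add: nonneg)
  qed simp
  have AA: "positive_op AA" "SS \<in> B_A AA"
    unfolding AA_def SS_def by (intro positive_op_diagonal antidiagonal_in_B_A assms)+
  interpret A: positive_operator A by standard fact
  interpret AA: positive_operator AA by standard fact
  have le: "cmod (A_inner AA ((A_sharp AA SS \<circ> TT) z) z) \<le> w" if z: "A_norm AA z = 1" for z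
  proof -
    \<comment> \<open>The adjoint passes to the other side, where the two antidiagonal operators
      pair T1 with S1 on the second component and T2 with S2 on the first.\<close>
    have "A_inner AA ((A_sharp AA SS \<circ> TT) z) z = A_inner AA (TT z) (SS z)"
      by (simp add: A_sharp(2)[OF AA])
    also have "\<dots> = A_inner A (T1 (snd z)) (S1 (snd z)) + A_inner A (T2 (fst z)) (S2 (fst z))"
      by (simp add: AA_def A_inner_diagonal) (simp add: TT_def SS_def block_op_def)
    also have "cmod \<dots> \<le> w * (A_norm A (snd z))\<^sup>2 + w * (A_norm A (fst z))\<^sup>2"
      by (intro order_trans[OF norm_triangle_ineq] add_mono 1 2)
    \<comment> \<open>The squared seminorms of the components are weights with sum 1, so the common
      bound w survives the addition.\<close>
    also have "(A_norm A (snd z))\<^sup>2 = 1 - (A_norm A (fst z))\<^sup>2"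
    proof -
      have "Re (A_inner AA z z) = 1" using AA.A_norm_square[of z] z by (simp add: AA.semi_inner_def)
      then show ?thesis
        by (simp add: AA_def A_inner_diagonal A.A_norm_square A.semi_inner_def)
    qed
    finally show ?thesis by (simp add: algebra_simps)
  qed
  have w: "0 \<le> w" by (simp add: w_def)
  have "A_numrad AA (A_sharp AA SS \<circ> TT) \<le> w"
    unfolding A_numrad_def by (rule cSup_least) (use le w in auto)
  \<comment> \<open>Nonnegativity comes from the inserted 0 in \<open>A_numrad\<close> and is
    required for monotonicity of \<open>powr\<close> in the base.\<close>
  moreover have "0 \<le> A_numrad AA (A_sharp AA SS \<circ> TT)"
    unfolding A_numrad_def by (rule cSup_upper) (use le w in \<open>auto intro!: bdd_aboveI[of _ w]\<close>)
  ultimately have "A_numrad AA (A_sharp AA SS \<circ> TT) powr (4 * r) \<le> w powr (4 * r)"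
    using \<open>r \<ge> 1\<close> by (intro powr_mono2) auto
  also have "\<dots> = W" using W \<open>r \<ge> 1\<close> by (simp add: w_def powr_powr)
  finally show ?thesis
    unfolding Let_def W_def \<phi>_def \<psi>_def \<rho>_def \<theta>_def AA_def TT_def SS_def .
qed

end
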